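(* Let $\mathcal{A}$ be a pointed Barr exact Goursat category and $\mathcal{B}$ a Birkhoff subcategory of $\mathcal{A}$ with reflector $\mathsf{b}$. Let $u\colon U\to A$ be a $\mathsf{b}$-central extension. Consider the following conditions: (1) $U$ is $\mathsf{b}$-perfect and every $\mathsf{b}$-central extension of $U$ splits; (2) $U$ is $\mathsf{b}$-perfect and projective with respect to all $\mathsf{b}$-central extensions; (3) for every $\mathsf{b}$-central extension $f\colon X\to Y$ in $\mathcal{A}$, the map $\mathrm{Hom}(U,f)=f\circ(-)\colon\mathrm{Hom}(U,X)\to\mathrm{Hom}(U,Y)$ is a bijection; (4) $U$ is $\mathsf{b}$-perfect and $u$ is a weakly universal $\mathsf{b}$-central extension; (5) $u$ is a universal $\mathsf{b}$-central extension. Then the implications $(1)\Leftrightarrow(2)\Leftrightarrow(3)\Rightarrow(4)\Leftrightarrow(5)$ hold.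
   Context: A regular epimorphism is a coequaliser of some pair of arrows. A category is regular when it is finitely complete with coequalisers of kernel pairs and pullback-stable regular epimorphisms; it is Barr exact when it is regular and every internal equivalence relation is a kernel pair. A Barr exact category is Goursat when $SRS=RSR$ for all equivalence relations $R,S$ on a common object. A category is pointed when its terminal object is also initial; this object is denoted $0$. A Birkhoff subcategory $\mathcal{B}$ of $\mathcal{A}$ is a full and reflective subcategory closed under subobjects and regular quotients; its reflector is $\mathsf{b}\colon\mathcal{A}\to\mathcal{B}$, with unit $\eta\colon 1_{\mathcal{A}}\Rightarrow\mathsf{b}$. An extension in $\mathcal{A}$ is a regular epimorphism; an extension of $A$ is one with codomain $A$. An extension $f\colon B\to A$ is $\mathsf{b}$-trivial if the naturality square $\mathsf{b}(f)\circ\eta_B=\eta_A\circ f$ is a pullback; it is $\mathsf{b}$-central if there is an extension $g\colon C\to A$ such that the pullback $g^*(f)$ of $f$ along $g$ is $\mathsf{b}$-trivial. An object $P$ of $\mathcal{A}$ is $\mathsf{b}$-perfect when $\mathsf{b}(P)=0$. $\mathsf{Centr}_{\mathsf{b}}(A)$ is the full subcategory of the slice category $(\mathcal{A}\downarrow A)$ determined by the $\mathsf{b}$-central extensions of $A$. A (weakly) universal $\mathsf{b}$-central extension of $A$ is a (weakly) initial object of $\mathsf{Centr}_{\mathsf{b}}(A)$. An object $U$ is projective with respect to all $\mathsf{b}$-central extensions when for every $\mathsf{b}$-central extension $f\colon X\to Y$ and every morphism $g\colon U\to Y$ there is a morphism $h\colon U\to X$ with $f\circ h=g$. An extension splits when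 it admits a section. *)

theory Defs
  imports Main
begin

section \<open>Categories, functors, finite limits\<close>

text \<open>The operations are total functions; their values are meaningful only on the carriers
  \<open>Obj\<close> and \<open>Mor\<close>, and \<open>g \<odot> f\<close> only when \<open>Cod f = Dom g\<close>.\<close>

record ('o, 'm) cat =
  Obj :: "'o set"
  Mor :: "'m set"
  Dom :: "'m \<Rightarrow> 'o"
  Cod :: "'m \<Rightarrow> 'o"
  Id :: "'o \<Rightarrow> 'm"
  Comp :: "'m \<Rightarrow> 'm \<Rightarrow> 'm"  (infixr \<open>\<odot>\<index>\<close> 70)

definition hom :: "('o, 'm) cat \<Rightarrow> 'o \<Rightarrow> 'o \<Rightarrow> 'm set" where
  "hom C x y = {f \<in> Mor C. Dom C f = x \<and> Cod C f = y}"

locale category =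
  fixes C :: "('o, 'm) cat" (structure)
  assumes dom_obj: "f \<in> Mor C \<Longrightarrow> Dom C f \<in> Obj C"
    and cod_obj: "f \<in> Mor C \<Longrightarrow> Cod C f \<in> Obj C"
    and id_hom: "x \<in> Obj C \<Longrightarrow> Id C x \<in> hom C x x"
    and comp_hom: "f \<in> hom C x y \<Longrightarrow> g \<in> hom C y z \<Longrightarrow> g \<odot> f \<in> hom C x z"
    and comp_id_right: "f \<in> hom C x y \<Longrightarrow> f \<odot> Id C x = f"
    and comp_id_left: "f \<in> hom C x y \<Longrightarrow> Id C y \<odot> f = f"
    and comp_assoc: "f \<in> hom C w x \<Longrightarrow> g \<in> hom C x y \<Longrightarrow> h \<in> hom C y z
      \<Longrightarrow> (h \<odot> g) \<odot> f = h \<odot> (g \<odot> f)"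

definition full_subcat :: "('o, 'm) cat \<Rightarrow> 'o set \<Rightarrow> ('o, 'm) cat" where
  "full_subcat C S = C\<lparr>Obj := Obj C \<inter> S,
     Mor := {f \<in> Mor C. Dom C f \<in> S \<and> Cod C f \<in> S}\<rparr>"

text \<open>A morphism of the slice category is a commutative triangle, encoded as a triple
  \<open>(f, h, g)\<close> with \<open>g \<odot> h = f\<close>, regarded as a morphism from \<open>f\<close> to \<open>g\<close>.\<close>

definition slice_cat :: "('o, 'm) cat \<Rightarrow> 'o \<Rightarrow> ('m, 'm \<times> 'm \<times> 'm) cat" where
  "slice_cat C a = \<lparr>
     Obj = {f \<in> Mor C. Cod C f = a},
     Mor = {(f, h, g). f \<in> Mor C \<and> Cod C f = a \<and> g \<in> Mor C \<and> Cod C g = a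
              \<and> h \<in> hom C (Dom C f) (Dom C g) \<and> g \<odot>\<^bsub>C\<^esub> h = f},
     Dom = (\<lambda>(f, h, g). f),
     Cod = (\<lambda>(f, h, g). g),
     Id = (\<lambda>f. (f, Id C (Dom C f), f)),
     Comp = (\<lambda>(g', k, l) (f, h, g). (f, k \<odot>\<^bsub>C\<^esub> h, l))\<rparr>"

record ('o1, 'm1, 'o2, 'm2) ftor =
  OMap :: "'o1 \<Rightarrow> 'o2"
  MMap :: "'m1 \<Rightarrow> 'm2"

definition is_functor ::
  "('o1, 'm1) cat \<Rightarrow> ('o2, 'm2) cat \<Rightarrow> ('o1, 'm1, 'o2, 'm2) ftor \<Rightarrow> bool" where
  "is_functor C D F \<longleftrightarrow>
     (\<forall>x\<in>Obj C. OMap F x \<in> Obj D) \<and>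
     (\<forall>f\<in>Mor C. MMap F f \<in> hom D (OMap F (Dom C f)) (OMap F (Cod C f))) \<and>
     (\<forall>x\<in>Obj C. MMap F (Id C x) = Id D (OMap F x)) \<and>
     (\<forall>f\<in>Mor C. \<forall>g\<in>Mor C. Cod C f = Dom C g
        \<longrightarrow> MMap F (g \<odot>\<^bsub>C\<^esub> f) = MMap F g \<odot>\<^bsub>D\<^esub> MMap F f)"

definition is_cone :: "('j, 'k) cat \<Rightarrow> ('o, 'm) cat \<Rightarrow> ('j, 'k, 'o, 'm) ftor
    \<Rightarrow> 'o \<Rightarrow> ('j \<Rightarrow> 'm) \<Rightarrow> bool" where
  "is_cone J C D L l \<longleftrightarrow> L \<in> Obj C \<and>
     (\<forall>j\<in>Obj J. l j \<in> hom C L (OMap D j)) \<and>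
     (\<forall>k\<in>Mor J. MMap D k \<odot>\<^bsub>C\<^esub> l (Dom J k) = l (Cod J k))"

definition is_limit :: "('j, 'k) cat \<Rightarrow> ('o, 'm) cat \<Rightarrow> ('j, 'k, 'o, 'm) ftor
    \<Rightarrow> 'o \<Rightarrow> ('j \<Rightarrow> 'm) \<Rightarrow> bool" where
  "is_limit J C D L l \<longleftrightarrow> is_cone J C D L l \<and>
     (\<forall>M m. is_cone J C D M m \<longrightarrow>
        (\<exists>!h. h \<in> hom C M L \<and> (\<forall>j\<in>Obj J. l j \<odot>\<^bsub>C\<^esub> h = m j)))"

text \<open>Every finite category is isomorphic to one whose objects and morphisms are natural
  numbers, so it is enough to quantify over the latter.\<close>

definition finitely_complete :: "('o, 'm) cat \<Rightarrow> bool" where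
  "finitely_complete C \<longleftrightarrow>
     (\<forall>(J :: (nat, nat) cat) D.
        category J \<and> finite (Obj J) \<and> finite (Mor J) \<and> is_functor J C D
        \<longrightarrow> (\<exists>L l. is_limit J C D L l))"

definition is_terminal :: "('o, 'm) cat \<Rightarrow> 'o \<Rightarrow> bool" where
  "is_terminal C t \<longleftrightarrow> t \<in> Obj C \<and> (\<forall>x\<in>Obj C. \<exists>!f. f \<in> hom C x t)"

definition is_initial :: "('o, 'm) cat \<Rightarrow> 'o \<Rightarrow> bool" where
  "is_initial C i \<longleftrightarrow> i \<in> Obj C \<and> (\<forall>x\<in>Obj C. \<exists>!f. f \<in> hom C i x)"

definition is_weakly_initial :: "('o, 'm) cat \<Rightarrow> 'o \<Rightarrow> bool" where
  "is_weakly_initial C i \<longleftrightarrow> i \<in> Obj C \<and> (\<forall>x\<in>Obj C. \<exists>f. f \<in> hom C i x)"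

definition is_zero :: "('o, 'm) cat \<Rightarrow> 'o \<Rightarrow> bool" where
  "is_zero C z \<longleftrightarrow> is_terminal C z \<and> is_initial C z"

definition pointed :: "('o, 'm) cat \<Rightarrow> bool" where
  "pointed C \<longleftrightarrow> (\<exists>z. is_zero C z)"

definition is_mono :: "('o, 'm) cat \<Rightarrow> 'm \<Rightarrow> bool" where
  "is_mono C f \<longleftrightarrow> f \<in> Mor C \<and>
     (\<forall>w. \<forall>g\<in>hom C w (Dom C f). \<forall>h\<in>hom C w (Dom C f).
        f \<odot>\<^bsub>C\<^esub> g = f \<odot>\<^bsub>C\<^esub> h \<longrightarrow> g = h)"

definition is_iso :: "('o, 'm) cat \<Rightarrow> 'm \<Rightarrow> bool" where
  "is_iso C f \<longleftrightarrow> f \<in> Mor C \<and>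
     (\<exists>g\<in>hom C (Cod C f) (Dom C f).
        g \<odot>\<^bsub>C\<^esub> f = Id C (Dom C f) \<and> f \<odot>\<^bsub>C\<^esub> g = Id C (Cod C f))"

text \<open>\<open>is_pullback C f g p q\<close>: the square \<open>f \<odot> p = g \<odot> q\<close> is a pullback; \<open>p\<close> is then
  the pullback of \<open>g\<close> along \<open>f\<close>.\<close>

definition is_pullback :: "('o, 'm) cat \<Rightarrow> 'm \<Rightarrow> 'm \<Rightarrow> 'm \<Rightarrow> 'm \<Rightarrow> bool" where
  "is_pullback C f g p q \<longleftrightarrow>
     f \<in> Mor C \<and> g \<in> Mor C \<and> Cod C f = Cod C g \<and>
     p \<in> Mor C \<and> q \<in> Mor C \<and> Dom C p = Dom C q \<and> Cod C p = Dom C f \<and> Cod C q = Dom C g \<and>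
     f \<odot>\<^bsub>C\<^esub> p = g \<odot>\<^bsub>C\<^esub> q \<and>
     (\<forall>w. \<forall>x\<in>hom C w (Dom C f). \<forall>y\<in>hom C w (Dom C g). f \<odot>\<^bsub>C\<^esub> x = g \<odot>\<^bsub>C\<^esub> y \<longrightarrow>
        (\<exists>!h. h \<in> hom C w (Dom C p) \<and> p \<odot>\<^bsub>C\<^esub> h = x \<and> q \<odot>\<^bsub>C\<^esub> h = y))"

definition is_kernel_pair :: "('o, 'm) cat \<Rightarrow> 'm \<Rightarrow> 'm \<Rightarrow> 'm \<Rightarrow> bool" where
  "is_kernel_pair C f p q \<longleftrightarrow> is_pullback C f f p q"

definition is_coequaliser :: "('o, 'm) cat \<Rightarrow> 'm \<Rightarrow> 'm \<Rightarrow> 'm \<Rightarrow> bool" where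
  "is_coequaliser C p q e \<longleftrightarrow>
     p \<in> Mor C \<and> q \<in> Mor C \<and> Dom C p = Dom C q \<and> Cod C p = Cod C q \<and>
     e \<in> Mor C \<and> Dom C e = Cod C p \<and> e \<odot>\<^bsub>C\<^esub> p = e \<odot>\<^bsub>C\<^esub> q \<and>
     (\<forall>z. \<forall>h\<in>hom C (Cod C p) z. h \<odot>\<^bsub>C\<^esub> p = h \<odot>\<^bsub>C\<^esub> q \<longrightarrow>
        (\<exists>!k. k \<in> hom C (Cod C e) z \<and> k \<odot>\<^bsub>C\<^esub> e = h))"

definition is_regular_epi :: "('o, 'm) cat \<Rightarrow> 'm \<Rightarrow> bool" where
  "is_regular_epi C e \<longleftrightarrow> (\<exists>p q. is_coequaliser C p q e)"

section \<open>Regular, Barr exact and Goursat categories\<close>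

definition regular_category :: "('o, 'm) cat \<Rightarrow> bool" where
  "regular_category C \<longleftrightarrow> category C \<and> finitely_complete C \<and>
     (\<forall>f p q. is_kernel_pair C f p q \<longrightarrow> (\<exists>e. is_coequaliser C p q e)) \<and>
     (\<forall>f g p q. is_pullback C f g p q \<and> is_regular_epi C g \<longrightarrow> is_regular_epi C p)"

text \<open>An internal relation from \<open>x\<close> to \<open>y\<close> is a jointly monic span, given as the pair of
  its legs.\<close>

definition is_relation :: "('o, 'm) cat \<Rightarrow> 'o \<Rightarrow> 'o \<Rightarrow> 'm \<times> 'm \<Rightarrow> bool" where
  "is_relation C x y R \<longleftrightarrow> (case R of (r1, r2) \<Rightarrow>
     r1 \<in> Mor C \<and> r2 \<in> Mor C \<and> Dom C r1 = Dom C r2 \<and> Cod C r1 = x \<and> Cod C r2 = y \<and>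
     (\<forall>w. \<forall>g\<in>hom C w (Dom C r1). \<forall>h\<in>hom C w (Dom C r1).
        r1 \<odot>\<^bsub>C\<^esub> g = r1 \<odot>\<^bsub>C\<^esub> h \<and> r2 \<odot>\<^bsub>C\<^esub> g = r2 \<odot>\<^bsub>C\<^esub> h \<longrightarrow> g = h))"

text \<open>The last three conjuncts are reflexivity, symmetry and transitivity; in the last one,
  \<open>p, q\<close> are the projections of the object of pairs of consecutive elements of the relation.\<close>

definition is_equiv_relation :: "('o, 'm) cat \<Rightarrow> 'o \<Rightarrow> 'm \<times> 'm \<Rightarrow> bool" where
  "is_equiv_relation C x R \<longleftrightarrow> is_relation C x x R \<and> (case R of (r1, r2) \<Rightarrow>
     (\<exists>d\<in>hom C x (Dom C r1). r1 \<odot>\<^bsub>C\<^esub> d = Id C x \<and> r2 \<odot>\<^bsub>C\<^esub> d = Id C x) \<and>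
     (\<exists>s\<in>hom C (Dom C r1) (Dom C r1). r1 \<odot>\<^bsub>C\<^esub> s = r2 \<and> r2 \<odot>\<^bsub>C\<^esub> s = r1) \<and>
     (\<forall>p q. is_pullback C r2 r1 p q \<longrightarrow>
        (\<exists>t\<in>hom C (Dom C p) (Dom C r1).
           r1 \<odot>\<^bsub>C\<^esub> t = r1 \<odot>\<^bsub>C\<^esub> p \<and> r2 \<odot>\<^bsub>C\<^esub> t = r2 \<odot>\<^bsub>C\<^esub> q)))"

definition barr_exact :: "('o, 'm) cat \<Rightarrow> bool" where
  "barr_exact C \<longleftrightarrow> regular_category C \<and>
     (\<forall>x r1 r2. is_equiv_relation C x (r1, r2) \<longrightarrow> (\<exists>f. is_kernel_pair C f r1 r2))"

text \<open>\<open>T\<close> is a composite \<open>S R\<close> (first \<open>R\<close>, then \<open>S\<close>): the image in \<open>x \<times> z\<close> of the pullback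
  of the inner legs, i.e. the jointly monic part of its regular epi--mono factorisation.\<close>

definition is_rel_comp ::
  "('o, 'm) cat \<Rightarrow> 'm \<times> 'm \<Rightarrow> 'm \<times> 'm \<Rightarrow> 'm \<times> 'm \<Rightarrow> bool" where
  "is_rel_comp C S R T \<longleftrightarrow> (case (S, R, T) of ((s1, s2), (r1, r2), (t1, t2)) \<Rightarrow>
     is_relation C (Cod C r1) (Cod C s2) (t1, t2) \<and>
     (\<exists>p q e. is_pullback C r2 s1 p q \<and> is_regular_epi C e \<and> e \<in> hom C (Dom C p) (Dom C t1) \<and>
        t1 \<odot>\<^bsub>C\<^esub> e = r1 \<odot>\<^bsub>C\<^esub> p \<and> t2 \<odot>\<^bsub>C\<^esub> e = s2 \<odot>\<^bsub>C\<^esub> q))"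

definition is_rel_comp3 ::
  "('o, 'm) cat \<Rightarrow> 'm \<times> 'm \<Rightarrow> 'm \<times> 'm \<Rightarrow> 'm \<times> 'm \<Rightarrow> 'm \<times> 'm \<Rightarrow> bool" where
  "is_rel_comp3 C R3 R2 R1 T \<longleftrightarrow> (\<exists>Q. is_rel_comp C R2 R1 Q \<and> is_rel_comp C R3 Q T)"

text \<open>Equality of relations, as subobjects of the product.\<close>

definition rel_eq :: "('o, 'm) cat \<Rightarrow> 'm \<times> 'm \<Rightarrow> 'm \<times> 'm \<Rightarrow> bool" where
  "rel_eq C R S \<longleftrightarrow> (case (R, S) of ((r1, r2), (s1, s2)) \<Rightarrow>
     (\<exists>i\<in>hom C (Dom C r1) (Dom C s1). is_iso C i \<and> s1 \<odot>\<^bsub>C\<^esub> i = r1 \<and> s2 \<odot>\<^bsub>C\<^esub> i = r2))"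

text \<open>In a regular category composites of relations exist and are unique up to \<open>rel_eq\<close>,
  so the following says \<open>S R S = R S R\<close>.\<close>

definition goursat :: "('o, 'm) cat \<Rightarrow> bool" where
  "goursat C \<longleftrightarrow> barr_exact C \<and>
     (\<forall>x R S T T'. is_equiv_relation C x R \<and> is_equiv_relation C x S \<and>
        is_rel_comp3 C S R S T \<and> is_rel_comp3 C R S R T' \<longrightarrow> rel_eq C T T')"

section \<open>Birkhoff subcategories\<close>

text \<open>A full subcategory is given by its set of objects \<open>B\<close>; a reflector is given by the
  functor \<open>b\<close> together with the unit \<open>\<eta>\<close>, whose components are universal arrows.\<close>

definition is_reflector ::
  "('o, 'm) cat \<Rightarrow> 'o set \<Rightarrow> ('o, 'm, 'o, 'm) ftor \<Rightarrow> ('o \<Rightarrow> 'm) \<Rightarrow> bool" where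
  "is_reflector C B b \<eta> \<longleftrightarrow>
     is_functor C (full_subcat C B) b \<and>
     (\<forall>x\<in>Obj C. \<eta> x \<in> hom C x (OMap b x)) \<and>
     (\<forall>f\<in>Mor C. MMap b f \<odot>\<^bsub>C\<^esub> \<eta> (Dom C f) = \<eta> (Cod C f) \<odot>\<^bsub>C\<^esub> f) \<and>
     (\<forall>x\<in>Obj C. \<forall>y\<in>B. \<forall>f\<in>hom C x y. \<exists>!g. g \<in> hom C (OMap b x) y \<and> g \<odot>\<^bsub>C\<^esub> \<eta> x = f)"

definition birkhoff_subcategory :: "('o, 'm) cat \<Rightarrow> 'o set \<Rightarrow> bool" where
  "birkhoff_subcategory C B \<longleftrightarrow> B \<subseteq> Obj C \<and>
     (\<exists>b \<eta>. is_reflector C B b \<eta>) \<and>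
     (\<forall>m. is_mono C m \<and> Cod C m \<in> B \<longrightarrow> Dom C m \<in> B) \<and>
     (\<forall>e. is_regular_epi C e \<and> Dom C e \<in> B \<longrightarrow> Cod C e \<in> B)"

section \<open>Central extensions\<close>

definition extension :: "('o, 'm) cat \<Rightarrow> 'm \<Rightarrow> bool" where
  "extension C f \<longleftrightarrow> is_regular_epi C f"

definition trivial_extension ::
  "('o, 'm) cat \<Rightarrow> ('o, 'm, 'o, 'm) ftor \<Rightarrow> ('o \<Rightarrow> 'm) \<Rightarrow> 'm \<Rightarrow> bool" where
  "trivial_extension C b \<eta> f \<longleftrightarrow> extension C f \<and>
     is_pullback C (MMap b f) (\<eta> (Cod C f)) (\<eta> (Dom C f)) f"

definition central_extension ::
  "('o, 'm) cat \<Rightarrow> ('o, 'm, 'o, 'm) ftor \<Rightarrow> ('o \<Rightarrow> 'm) \<Rightarrow> 'm \<Rightarrow> bool" where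
  "central_extension C b \<eta> f \<longleftrightarrow> extension C f \<and>
     (\<exists>g p q. extension C g \<and> Cod C g = Cod C f \<and> is_pullback C g f p q \<and>
        trivial_extension C b \<eta> p)"

definition perfect :: "('o, 'm) cat \<Rightarrow> ('o, 'm, 'o, 'm) ftor \<Rightarrow> 'o \<Rightarrow> bool" where
  "perfect C b P \<longleftrightarrow> P \<in> Obj C \<and> is_zero C (OMap b P)"

definition Centr :: "('o, 'm) cat \<Rightarrow> ('o, 'm, 'o, 'm) ftor \<Rightarrow> ('o \<Rightarrow> 'm) \<Rightarrow> 'o
    \<Rightarrow> ('m, 'm \<times> 'm \<times> 'm) cat" where
  "Centr C b \<eta> a = full_subcat (slice_cat C a) {f. central_extension C b \<eta> f}"

definition universal_central_extension ::
  "('o, 'm) cat \<Rightarrow> ('o, 'm, 'o, 'm) ftor \<Rightarrow> ('o \<Rightarrow> 'm) \<Rightarrow> 'o \<Rightarrow> 'm \<Rightarrow> bool" where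
  "universal_central_extension C b \<eta> a u \<longleftrightarrow> is_initial (Centr C b \<eta> a) u"

definition weakly_universal_central_extension ::
  "('o, 'm) cat \<Rightarrow> ('o, 'm, 'o, 'm) ftor \<Rightarrow> ('o \<Rightarrow> 'm) \<Rightarrow> 'o \<Rightarrow> 'm \<Rightarrow> bool" where
  "weakly_universal_central_extension C b \<eta> a u \<longleftrightarrow> is_weakly_initial (Centr C b \<eta> a) u"

definition projective_wrt_central ::
  "('o, 'm) cat \<Rightarrow> ('o, 'm, 'o, 'm) ftor \<Rightarrow> ('o \<Rightarrow> 'm) \<Rightarrow> 'o \<Rightarrow> bool" where
  "projective_wrt_central C b \<eta> U \<longleftrightarrow> U \<in> Obj C \<and>
     (\<forall>f. central_extension C b \<eta> f \<longrightarrow>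
        (\<forall>g\<in>hom C U (Cod C f). \<exists>h\<in>hom C U (Dom C f). f \<odot>\<^bsub>C\<^esub> h = g))"

definition splits :: "('o, 'm) cat \<Rightarrow> 'm \<Rightarrow> bool" where
  "splits C f \<longleftrightarrow> (\<exists>s\<in>hom C (Cod C f) (Dom C f). f \<odot>\<^bsub>C\<^esub> s = Id C (Cod C f))"

end

theory Submission
  imports Defs
begin

text \<open>
  An arrow \<open>w \<rightarrow> x\<close> is treated as an element of \<open>x\<close> at stage \<open>w\<close>, and a regular epimorphism
  \<open>w' \<rightarrow> w\<close> as a cover of the stage \<open>w\<close>, to which elements may be restricted. In a regular
  category covers compose and pull back, elements of a quotient lift to elements of the original
  object on a cover, and membership in a relation can be checked on a cover. So the composite of
  two relations is given by the usual formula, with the middle element existing on a cover, and the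
  Goursat condition says: if \<open>a R b S c R d\<close> holds on a cover, then \<open>a S b' R c' S d\<close> holds
  on some cover, for suitable \<open>b'\<close> and \<open>c'\<close> (lemma \<open>goursat_swap\<close>).

  Two consequences carry the proof. Equivalence relations satisfy the modular law
  (\<open>modular_shift\<close>), because the join of \<open>R\<close> and \<open>Q\<close> is both \<open>R Q R\<close> and \<open>Q R Q\<close>. And a
  regular epimorphism \<open>f : x \<rightarrow> y\<close> maps the kernel relation of \<open>\<eta>\<^sub>x\<close> onto that of \<open>\<eta>\<^sub>y\<close>
  (\<open>unit_kernel_lift\<close>): the image is an equivalence relation, and its quotient is a quotient of
  \<open>b x\<close>, hence lies in the Birkhoff subcategory.

  From these, trivial extensions are stable under pullback (\<open>trivial_pullback\<close>), and therefore so
  are central ones. Moreover, a central extension \<open>f\<close> has a kernel pair whose projection is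
  injective on elements with equal reflections (\<open>central_kernel_unit_separated\<close>). All arrows from a
  perfect object to a given object have equal reflections, so two arrows from a perfect object that
  agree after composition with \<open>f\<close> are equal (\<open>perfect_central_cancel\<close>).

  The theorem follows. A lifting problem against a central extension of any object becomes,
  after pullback, the problem of splitting a central extension of \<open>U\<close>. Perfection turns
  existence of lifts into uniqueness as well. Conversely, if \<open>\<eta>\<^sub>U\<close> equals the zero arrow then \<open>U\<close> is
  perfect, and uniqueness of lifts gives this equality when it is applied to the trivial extension
  \<open>b U \<rightarrow> 0\<close> or to its pullback \<open>A \<times> b U \<rightarrow> A\<close>.
\<close>

section \<open>Arrows as generalised elements\<close>

context category
begin

lemma comp_Mor [simp]:
  assumes "f \<in> Mor C" "g \<in> Mor C" "Cod C f = Dom C g"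
  shows "g \<odot> f \<in> Mor C" "Dom C (g \<odot> f) = Dom C f" "Cod C (g \<odot> f) = Cod C g"
  using comp_hom[of f "Dom C f" "Cod C f" g "Cod C g"] assms by (auto simp: hom_def)

lemma comp_assoc_Mor:
  assumes "f \<in> Mor C" "g \<in> Mor C" "h \<in> Mor C" "Cod C f = Dom C g" "Cod C g = Dom C h"
  shows "(h \<odot> g) \<odot> f = h \<odot> (g \<odot> f)"
  using comp_assoc[of f "Dom C f" "Cod C f" g "Cod C g" h "Cod C h"] assms
  by (auto simp: hom_def)

lemma Id_Mor [simp]:
  assumes "x \<in> Obj C"
  shows "Id C x \<in> Mor C" "Dom C (Id C x) = x" "Cod C (Id C x) = x"
  using id_hom[OF assms] by (auto simp: hom_def)

lemma comp_Id_Mor [simp]: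
  assumes "f \<in> Mor C"
  shows "Dom C f = x \<Longrightarrow> f \<odot> Id C x = f" "Cod C f = x \<Longrightarrow> Id C x \<odot> f = f"
  using assms comp_id_right[of f "Dom C f" "Cod C f"] comp_id_left[of f "Dom C f" "Cod C f"]
  by (auto simp: hom_def)

lemma homD:
  assumes "f \<in> hom C x y"
  shows "f \<in> Mor C" "Dom C f = x" "Cod C f = y" "x \<in> Obj C" "y \<in> Obj C"
proof -
  show "f \<in> Mor C" "Dom C f = x" "Cod C f = y" using assms by (simp_all add: hom_def)
  then show "x \<in> Obj C" "y \<in> Obj C" using dom_obj cod_obj by blast+
qed

lemma hom_dom_cod: "f \<in> Mor C \<Longrightarrow> f \<in> hom C (Dom C f) (Cod C f)"
  by (simp add: hom_def)

text \<open>Composites are kept nested to the right; this lemma and the next apply an equation between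
  composites to an element.\<close>

lemma comp_pre:
  assumes "g \<odot> p = r" "a \<in> hom C w x" "p \<in> hom C x y" "g \<in> hom C y z"
  shows "g \<odot> (p \<odot> a) = r \<odot> a"
  using comp_assoc[OF assms(2-4)] assms(1) by simp

lemma comp_square:
  assumes "g \<odot> p = f \<odot> q" "a \<in> hom C w x" "p \<in> hom C x y" "g \<in> hom C y z"
    "q \<in> hom C x y'" "f \<in> hom C y' z"
  shows "g \<odot> (p \<odot> a) = f \<odot> (q \<odot> a)"
  using comp_assoc[OF assms(2,3,4)] comp_assoc[OF assms(2,5,6)] assms(1) by simp

text \<open>Elements at stage \<open>w\<close> are restricted along \<open>v\<close> to the stage \<open>w'\<close>.\<close>

definition cover :: "'m \<Rightarrow> 'o \<Rightarrow> 'o \<Rightarrow> bool" where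
  "cover v w' w \<longleftrightarrow> v \<in> hom C w' w \<and> is_regular_epi C v"

lemma cover_hom: "cover v w' w \<Longrightarrow> v \<in> hom C w' w"
  by (simp add: cover_def)

lemma coequaliserD:
  assumes "is_coequaliser C p q e" and e: "e \<in> hom C x y"
  shows "p \<in> hom C (Dom C p) x" "q \<in> hom C (Dom C p) x" "e \<odot> p = e \<odot> q"
    "h \<in> hom C x z \<Longrightarrow> h \<odot> p = h \<odot> q \<Longrightarrow> \<exists>!k. k \<in> hom C y z \<and> k \<odot> e = h"
proof -
  have c: "p \<in> Mor C" "q \<in> Mor C" "Dom C q = Dom C p" "Cod C q = Cod C p" "Cod C p = x"
      "e \<odot> p = e \<odot> q"
    and u: "\<forall>z. \<forall>h\<in>hom C x z. h \<odot> p = h \<odot> q \<longrightarrow> (\<exists>!k. k \<in> hom C y z \<and> k \<odot> e = h)"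
    using assms(1) homD[OF e] unfolding is_coequaliser_def by simp_all
  show "p \<in> hom C (Dom C p) x" "q \<in> hom C (Dom C p) x" "e \<odot> p = e \<odot> q"
    using c by (simp_all add: hom_def)
  show "h \<in> hom C x z \<Longrightarrow> h \<odot> p = h \<odot> q \<Longrightarrow> \<exists>!k. k \<in> hom C y z \<and> k \<odot> e = h"
    using u by blast
qed

text \<open>The parallel pair that \<open>e\<close> coequalises is itself a pair of elements identified by \<open>e\<close>, so
  it need not be mentioned: a cover is the quotient by all identifications that it makes.\<close>

lemma cover_factor:
  assumes e: "cover e x y" and f: "f \<in> hom C x z"
    and ker: "\<And>w a b. a \<in> hom C w x \<Longrightarrow> b \<in> hom C w x \<Longrightarrow> e \<odot> a = e \<odot> b \<Longrightarrow> f \<odot> a = f \<odot> b"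
  shows "\<exists>k\<in>hom C y z. k \<odot> e = f"
proof -
  obtain p q where pq: "is_coequaliser C p q e" and eh: "e \<in> hom C x y"
    using e by (auto simp: cover_def is_regular_epi_def)
  note c = coequaliserD[OF pq eh]
  have "f \<odot> p = f \<odot> q" using c(1-3) by (rule ker)
  then show ?thesis using c(4)[OF f] by blast
qed

lemma cover_cancel:
  assumes e: "cover e x y" and a: "a \<in> hom C y z" and b: "b \<in> hom C y z"
    and eq: "a \<odot> e = b \<odot> e"
  shows "a = b"
proof -
  obtain p q where pq: "is_coequaliser C p q e" and eh: "e \<in> hom C x y"
    using e by (auto simp: cover_def is_regular_epi_def)
  note p = coequaliserD[OF pq eh]
  have "(a \<odot> e) \<odot> p = (a \<odot> e) \<odot> q"
    using comp_assoc[OF p(1) eh a] comp_assoc[OF p(2) eh a] p(3) by simp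
  moreover have "a \<odot> e \<in> hom C x z" using eh a by (rule comp_hom)
  ultimately have "\<exists>!k. k \<in> hom C y z \<and> k \<odot> e = a \<odot> e"
    using p(4) by simp
  then show ?thesis using a b eq by metis
qed

lemma cover_Id:
  assumes "x \<in> Obj C" shows "cover (Id C x) x x"
proof -
  have "is_coequaliser C (Id C x) (Id C x) (Id C x)"
    unfolding is_coequaliser_def using assms
    by (auto simp: hom_def intro!: ex1I)
  then show ?thesis using id_hom[OF assms] by (auto simp: cover_def is_regular_epi_def)
qed

text \<open>A split epimorphism with section \<open>s\<close> is the coequaliser of \<open>s \<odot> e\<close> and the identity.\<close>

lemma split_cover:
  assumes e: "e \<in> hom C x y" and s: "s \<in> hom C y x" and es: "e \<odot> s = Id C y"
  shows "cover e x y"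
proof -
  note E = homD[OF e] and S = homD[OF s]
  have "is_coequaliser C (s \<odot> e) (Id C x) e"
    unfolding is_coequaliser_def
  proof (intro conjI allI ballI impI)
    show "e \<odot> (s \<odot> e) = e \<odot> Id C x"
      using E S es by (simp add: comp_assoc_Mor[symmetric])
    fix z h assume h: "h \<in> hom C (Cod C (s \<odot> e)) z"
      and eq: "h \<odot> (s \<odot> e) = h \<odot> Id C x"
    have H: "h \<in> Mor C" "Dom C h = x" "Cod C h = z" using h E S by (auto simp: hom_def)
    show "\<exists>!k. k \<in> hom C (Cod C e) z \<and> k \<odot> e = h"
    proof (rule ex1I)
      show "h \<odot> s \<in> hom C (Cod C e) z \<and> (h \<odot> s) \<odot> e = h"
        using H E S eq by (simp add: hom_def comp_assoc_Mor)
      fix k assume k: "k \<in> hom C (Cod C e) z \<and> k \<odot> e = h"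
      then have "k \<in> Mor C" "Dom C k = y" using E by (auto simp: hom_def)
      then have "h \<odot> s = k \<odot> (e \<odot> s)" using k E S by (auto simp: comp_assoc_Mor)
      then show "k = h \<odot> s" using es \<open>k \<in> Mor C\<close> \<open>Dom C k = y\<close> by simp
    qed
  qed (use E S in auto)
  then show ?thesis using e by (auto simp: cover_def is_regular_epi_def)
qed

lemma cover_comp_iso:
  assumes e: "cover e x y" and i: "i \<in> hom C y z" and iso: "is_iso C i"
  shows "cover (i \<odot> e) x z"
proof -
  obtain p q where pq: "is_coequaliser C p q e" and eh: "e \<in> hom C x y"
    using e by (auto simp: cover_def is_regular_epi_def)
  note E = homD[OF eh] and I = homD[OF i]
  have P: "p \<in> Mor C" "q \<in> Mor C" "Dom C p = Dom C q" "Cod C p = x" "Cod C q = x"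
    "e \<odot> p = e \<odot> q"
    using pq E by (auto simp: is_coequaliser_def)
  obtain j where j: "j \<in> hom C z y" and ji: "j \<odot> i = Id C y" and ij: "i \<odot> j = Id C z"
    using iso I by (auto simp: is_iso_def)
  note J = homD[OF j]
  have "is_coequaliser C p q (i \<odot> e)"
    unfolding is_coequaliser_def
  proof (intro conjI allI ballI impI)
    show "(i \<odot> e) \<odot> p = (i \<odot> e) \<odot> q"
      using P E I by (simp add: comp_assoc_Mor)
    fix t h assume h: "h \<in> hom C (Cod C p) t" and eq: "h \<odot> p = h \<odot> q"
    then obtain k where k: "k \<in> hom C y t" "k \<odot> e = h"
      and uniq: "\<And>k'. k' \<in> hom C y t \<Longrightarrow> k' \<odot> e = h \<Longrightarrow> k' = k"
      using pq E unfolding is_coequaliser_def by blast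
    note K = homD[OF k(1)]
    show "\<exists>!l. l \<in> hom C (Cod C (i \<odot> e)) t \<and> l \<odot> (i \<odot> e) = h"
    proof (rule ex1I)
      have "(k \<odot> j) \<odot> (i \<odot> e) = k \<odot> ((j \<odot> i) \<odot> e)"
        using K J I E by (simp add: comp_assoc_Mor)
      then show "k \<odot> j \<in> hom C (Cod C (i \<odot> e)) t \<and> (k \<odot> j) \<odot> (i \<odot> e) = h"
        using K J I E ji k by (simp add: hom_def)
      fix l assume l: "l \<in> hom C (Cod C (i \<odot> e)) t \<and> l \<odot> (i \<odot> e) = h"
      then have L: "l \<in> Mor C" "Dom C l = z" "Cod C l = t" using E I by (auto simp: hom_def)
      have "l \<odot> i = k"
        using uniq[of "l \<odot> i"] L I E l by (simp add: hom_def comp_assoc_Mor)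
      then have "k \<odot> j = l \<odot> (i \<odot> j)" using L I J by (auto simp: comp_assoc_Mor)
      then show "l = k \<odot> j" using L ij by simp
    qed
  qed (use P E I in auto)
  then show ?thesis using comp_hom[OF eh i] by (auto simp: cover_def is_regular_epi_def)
qed

lemma pullback_hom:
  assumes "is_pullback C f g p q" "f \<in> hom C x z" "g \<in> hom C y z"
  obtains P where "p \<in> hom C P x" "q \<in> hom C P y" "f \<odot> p = g \<odot> q"
  using assms by (auto simp: is_pullback_def hom_def)

lemma pullback_lift:
  assumes "is_pullback C f g p q" "p \<in> hom C P x" "q \<in> hom C P y"
    "a \<in> hom C w x" "b \<in> hom C w y" "f \<odot> a = g \<odot> b"
  obtains h where "h \<in> hom C w P" "p \<odot> h = a" "q \<odot> h = b"
proof -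
  have "Dom C f = x" "Dom C g = y" "Dom C p = P"
    using assms(1-3) by (auto simp: is_pullback_def hom_def)
  then have "\<exists>!h. h \<in> hom C w P \<and> p \<odot> h = a \<and> q \<odot> h = b"
    using assms(1,4-6) unfolding is_pullback_def by metis
  then show ?thesis using that by blast
qed

lemma pullback_jointly_mono:
  assumes pb: "is_pullback C f g p q" and p: "p \<in> hom C P x" and q: "q \<in> hom C P y"
    and a: "a \<in> hom C w P" and b: "b \<in> hom C w P" and eq: "p \<odot> a = p \<odot> b" "q \<odot> a = q \<odot> b"
  shows "a = b"
proof -
  have F: "f \<in> Mor C" "g \<in> Mor C" "Dom C f = x" "Dom C g = y" "Dom C p = P" "Cod C f = Cod C g"
    "f \<odot> p = g \<odot> q"
    using pb p q by (auto simp: is_pullback_def hom_def)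
  have "f \<odot> (p \<odot> a) = g \<odot> (q \<odot> a)"
    using F homD[OF p] homD[OF q] homD[OF a] by (simp add: comp_assoc_Mor[symmetric])
  then have "\<exists>!h. h \<in> hom C w P \<and> p \<odot> h = p \<odot> a \<and> q \<odot> h = q \<odot> a"
    using pb F comp_hom[OF a p] comp_hom[OF a q] unfolding is_pullback_def by metis
  then show ?thesis using a b eq by metis
qed

lemma pullbackI:
  assumes "f \<in> hom C x z" "g \<in> hom C y z" "p \<in> hom C P x" "q \<in> hom C P y" "f \<odot> p = g \<odot> q"
    and lift: "\<And>w a b. a \<in> hom C w x \<Longrightarrow> b \<in> hom C w y \<Longrightarrow> f \<odot> a = g \<odot> b \<Longrightarrow>
      \<exists>h\<in>hom C w P. p \<odot> h = a \<and> q \<odot> h = b"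
    and mono: "\<And>w a b. a \<in> hom C w P \<Longrightarrow> b \<in> hom C w P \<Longrightarrow> p \<odot> a = p \<odot> b \<Longrightarrow>
      q \<odot> a = q \<odot> b \<Longrightarrow> a = b"
  shows "is_pullback C f g p q"
proof -
  note [simp] = homD[OF assms(1)] homD[OF assms(2)] homD[OF assms(3)] homD[OF assms(4)]
  have "\<exists>!h. h \<in> hom C w P \<and> p \<odot> h = a \<and> q \<odot> h = b"
    if ab: "a \<in> hom C w x" "b \<in> hom C w y" "f \<odot> a = g \<odot> b" for w a b
  proof -
    obtain h where "h \<in> hom C w P" "p \<odot> h = a" "q \<odot> h = b"
      using lift[OF ab] by blast
    moreover have "k = h" if "k \<in> hom C w P \<and> p \<odot> k = a \<and> q \<odot> k = b" for k
      using mono[of k w h] calculation that by simp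
    ultimately show ?thesis by blast
  qed
  then show ?thesis
    using assms(5) unfolding is_pullback_def by simp
qed

lemma pullback_flip:
  assumes "is_pullback C f g p q" shows "is_pullback C g f q p"
proof -
  have "\<exists>!h. h \<in> hom C w (Dom C q) \<and> q \<odot> h = a \<and> p \<odot> h = b"
    if "a \<in> hom C w (Dom C g)" "b \<in> hom C w (Dom C f)" "g \<odot> a = f \<odot> b" for w a b
  proof -
    have "\<exists>!h. h \<in> hom C w (Dom C p) \<and> p \<odot> h = b \<and> q \<odot> h = a"
      using assms that(1,2) that(3)[symmetric] unfolding is_pullback_def by blast
    moreover have "Dom C p = Dom C q" using assms by (simp add: is_pullback_def)
    ultimately show ?thesis by (simp add: conj_commute conj_left_commute)
  qed
  then show ?thesis using assms unfolding is_pullback_def by simp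
qed

text \<open>Membership of the element \<open>(a, b)\<close> of the product in the relation \<open>R\<close>, viewed as a
  subobject; the stage is read off from \<open>a\<close>.\<close>

definition related :: "'m \<times> 'm \<Rightarrow> 'm \<Rightarrow> 'm \<Rightarrow> bool" where
  "related R a b \<longleftrightarrow> (\<exists>h\<in>hom C (Dom C a) (Dom C (fst R)). fst R \<odot> h = a \<and> snd R \<odot> h = b)"

lemma relation_hom:
  assumes "is_relation C x y (r1, r2)"
  shows "r1 \<in> hom C (Dom C r1) x" "r2 \<in> hom C (Dom C r1) y"
  using assms by (auto simp: is_relation_def hom_def)

lemma related_precomp:
  assumes R: "is_relation C x y R" and a: "a \<in> hom C w x" and v: "v \<in> hom C w' w"
    and rel: "related R a b"
  shows "related R (a \<odot> v) (b \<odot> v)"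
proof -
  obtain r1 r2 where R2: "R = (r1, r2)" by force
  note r = relation_hom[OF R[unfolded R2]]
  obtain h where h: "h \<in> hom C w (Dom C r1)" "r1 \<odot> h = a" "r2 \<odot> h = b"
    using rel homD[OF a] by (auto simp: related_def R2)
  have "Dom C (a \<odot> v) = w'" using homD[OF a] homD[OF v] by simp
  moreover have "r1 \<odot> (h \<odot> v) = a \<odot> v" "r2 \<odot> (h \<odot> v) = b \<odot> v"
    using comp_pre[OF h(2) v h(1) r(1)] comp_pre[OF h(3) v h(1) r(2)] .
  ultimately show ?thesis using comp_hom[OF v h(1)] by (auto simp: related_def R2)
qed

text \<open>The element of \<open>R\<close> that represents the restricted pair identifies whatever \<open>v\<close>
  identifies, because the legs of \<open>R\<close> are jointly monic; hence it descends along \<open>v\<close>.\<close>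

lemma related_descent:
  assumes R: "is_relation C x y R" and a: "a \<in> hom C w x" and b: "b \<in> hom C w y"
    and v: "cover v w' w" and rel: "related R (a \<odot> v) (b \<odot> v)"
  shows "related R a b"
proof -
  obtain r1 r2 where R2: "R = (r1, r2)" by force
  note r = relation_hom[OF R[unfolded R2]]
  note vh = cover_hom[OF v]
  have "Dom C (a \<odot> v) = w'" using homD[OF a] homD[OF vh] by simp
  then obtain h where h: "h \<in> hom C w' (Dom C r1)" "r1 \<odot> h = a \<odot> v" "r2 \<odot> h = b \<odot> v"
    using rel by (auto simp: related_def R2)
  have "\<exists>k\<in>hom C w (Dom C r1). k \<odot> v = h"
  proof (rule cover_factor[OF v h(1)])
    fix t c d assume c: "c \<in> hom C t w'" and d: "d \<in> hom C t w'" and eq: "v \<odot> c = v \<odot> d"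
    have "r1 \<odot> (h \<odot> c) = r1 \<odot> (h \<odot> d)" "r2 \<odot> (h \<odot> c) = r2 \<odot> (h \<odot> d)"
      using comp_square[OF h(2) c h(1) r(1) vh a] comp_square[OF h(2) d h(1) r(1) vh a]
        comp_square[OF h(3) c h(1) r(2) vh b] comp_square[OF h(3) d h(1) r(2) vh b] eq
      by simp_all
    then show "h \<odot> c = h \<odot> d"
      using R comp_hom[OF c h(1)] comp_hom[OF d h(1)] by (auto simp: is_relation_def R2)
  qed
  then obtain k where k: "k \<in> hom C w (Dom C r1)" "k \<odot> v = h" by blast
  have "(r1 \<odot> k) \<odot> v = a \<odot> v" "(r2 \<odot> k) \<odot> v = b \<odot> v"
    using comp_assoc[OF vh k(1) r(1)] comp_assoc[OF vh k(1) r(2)] k h by simp_all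
  then have "r1 \<odot> k = a" "r2 \<odot> k = b"
    using cover_cancel[OF v comp_hom[OF k(1) r(1)] a] cover_cancel[OF v comp_hom[OF k(1) r(2)] b]
    by auto
  then show ?thesis using k homD[OF a] by (auto simp: related_def R2)
qed

lemma related_refl:
  assumes R: "is_equiv_relation C x R" and a: "a \<in> hom C w x"
  shows "related R a a"
proof -
  obtain r1 r2 where R2: "R = (r1, r2)" by force
  have R': "is_relation C x x (r1, r2)" using R by (simp add: is_equiv_relation_def R2)
  note r = relation_hom[OF R']
  obtain d where d: "d \<in> hom C x (Dom C r1)" "r1 \<odot> d = Id C x" "r2 \<odot> d = Id C x"
    using R by (auto simp: is_equiv_relation_def R2)
  have "r1 \<odot> (d \<odot> a) = a" "r2 \<odot> (d \<odot> a) = a"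
    using comp_pre[OF d(2) a d(1) r(1)] comp_pre[OF d(3) a d(1) r(2)] comp_id_left[OF a]
    by simp_all
  then show ?thesis using comp_hom[OF a d(1)] homD[OF a] by (auto simp: related_def R2)
qed

lemma related_sym:
  assumes R: "is_equiv_relation C x R" and a: "a \<in> hom C w x" and b: "b \<in> hom C w x"
    and ab: "related R a b"
  shows "related R b a"
proof -
  obtain r1 r2 where R2: "R = (r1, r2)" by force
  have R': "is_relation C x x (r1, r2)" using R by (simp add: is_equiv_relation_def R2)
  note r = relation_hom[OF R']
  obtain s where s: "s \<in> hom C (Dom C r1) (Dom C r1)" "r1 \<odot> s = r2" "r2 \<odot> s = r1"
    using R by (auto simp: is_equiv_relation_def R2)
  obtain h where h: "h \<in> hom C w (Dom C r1)" "r1 \<odot> h = a" "r2 \<odot> h = b"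
    using ab homD[OF a] by (auto simp: related_def R2)
  have "r1 \<odot> (s \<odot> h) = b" "r2 \<odot> (s \<odot> h) = a"
    using comp_pre[OF s(2) h(1) s(1) r(1)] comp_pre[OF s(3) h(1) s(1) r(2)] h by simp_all
  then show ?thesis using comp_hom[OF h(1) s(1)] homD[OF b] by (auto simp: related_def R2)
qed

end

section \<open>Finite limits and images in a regular category\<close>

text \<open>The shape of a pullback diagram: \<open>0\<close>, \<open>1\<close>, \<open>2\<close> are both the objects and their
  identities, and \<open>3 : 0 \<rightarrow> 2\<close> and \<open>4 : 1 \<rightarrow> 2\<close> are the other two arrows. In a composable pair at
  least one factor is an identity.\<close>

definition cospan :: "(nat, nat) cat" where
  "cospan = \<lparr>Obj = {0, 1, 2}, Mor = {0, 1, 2, 3, 4},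
     Dom = (\<lambda>k. if k = 3 then 0 else if k = 4 then 1 else k),
     Cod = (\<lambda>k. if k < 3 then k else 2),
     Id = (\<lambda>k. k),
     Comp = (\<lambda>g f. if g < 3 then f else g)\<rparr>"

lemma category_cospan: "category cospan"
  by standard (auto simp: cospan_def hom_def split: if_splits)

locale regular_cat = category C for C :: "('o, 'm) cat" (structure) +
  assumes regular: "regular_category C"
begin

definition cospan_diagram :: "'m \<Rightarrow> 'm \<Rightarrow> (nat, nat, 'o, 'm) ftor" where
  "cospan_diagram f g = (let ob = (\<lambda>k. if k = 0 then Dom C f else if k = 1 then Dom C g else Cod C f)
     in \<lparr>OMap = ob, MMap = (\<lambda>k. if k = 3 then f else if k = 4 then g else Id C (ob k))\<rparr>)"

lemma is_functor_cospan_diagram: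
  assumes "f \<in> hom C x z" "g \<in> hom C y z"
  shows "is_functor cospan C (cospan_diagram f g)"
  using homD[OF assms(1)] homD[OF assms(2)]
  by (simp add: is_functor_def cospan_def cospan_diagram_def hom_def)

lemma is_cone_cospan:
  assumes "f \<in> hom C x z" "g \<in> hom C y z"
  shows "is_cone cospan C (cospan_diagram f g) L l \<longleftrightarrow>
    l 0 \<in> hom C L x \<and> l 1 \<in> hom C L y \<and> l 2 \<in> hom C L z \<and> f \<odot> l 0 = l 2 \<and> g \<odot> l 1 = l 2"
  using homD[OF assms(1)] homD[OF assms(2)] homD(4)[of "l 0" L x]
  by (auto simp: is_cone_def cospan_def cospan_diagram_def hom_def)

lemma pullback_exists:
  assumes f: "f \<in> hom C x z" and g: "g \<in> hom C y z"
  obtains P p q where "is_pullback C f g p q" "p \<in> hom C P x" "q \<in> hom C P y" "f \<odot> p = g \<odot> q"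
proof -
  have fin: "finite (Obj cospan)" "finite (Mor cospan)" by (simp_all add: cospan_def)
  have ob: "Obj cospan = {0, 1, 2}" by (simp add: cospan_def)
  obtain P l where lim: "is_limit cospan C (cospan_diagram f g) P l"
    using regular category_cospan fin is_functor_cospan_diagram[OF f g]
    unfolding regular_category_def finitely_complete_def by meson
  note cone = is_cone_cospan[OF f g]
  have l: "l 0 \<in> hom C P x" "l 1 \<in> hom C P y" "l 2 \<in> hom C P z" "f \<odot> l 0 = l 2" "g \<odot> l 1 = l 2"
    using lim cone by (simp_all add: is_limit_def)
  have univ: "\<exists>!h. h \<in> hom C w P \<and> l 0 \<odot> h = m 0 \<and> l 1 \<odot> h = m 1 \<and> l 2 \<odot> h = m 2"
    if "is_cone cospan C (cospan_diagram f g) w m" for w m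
    using lim that by (simp add: is_limit_def ob)
  have "is_pullback C f g (l 0) (l 1)"
  proof (rule pullbackI[OF f g l(1,2)])
    show "f \<odot> l 0 = g \<odot> l 1" using l by simp
    fix w a b
    assume ab: "a \<in> hom C w x" "b \<in> hom C w y" "f \<odot> a = g \<odot> b"
    define m where "m k = (if k = 0 then a else if k = 1 then b else f \<odot> a)" for k :: nat
    have "is_cone cospan C (cospan_diagram f g) w m"
      using ab comp_hom[OF ab(1) f] by (simp add: cone m_def)
    from univ[OF this] show "\<exists>h\<in>hom C w P. l 0 \<odot> h = a \<and> l 1 \<odot> h = b"
      by (auto simp: m_def)
  next
    fix w a b
    assume a: "a \<in> hom C w P" and b: "b \<in> hom C w P"
      and eq: "l 0 \<odot> a = l 0 \<odot> b" "l 1 \<odot> a = l 1 \<odot> b"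
    have sq: "f \<odot> l 0 \<odot> a = l 2 \<odot> a" "g \<odot> l 1 \<odot> a = l 2 \<odot> a" "f \<odot> l 0 \<odot> b = l 2 \<odot> b"
      using comp_pre[OF l(4) a l(1) f] comp_pre[OF l(5) a l(2) g] comp_pre[OF l(4) b l(1) f]
      by simp_all
    have "is_cone cospan C (cospan_diagram f g) w (\<lambda>k. l k \<odot> a)"
      using comp_hom[OF a l(1)] comp_hom[OF a l(2)] comp_hom[OF a l(3)] sq by (simp add: cone)
    from univ[OF this] show "a = b" using a b eq sq by metis
  qed
  then show ?thesis using that l by metis
qed

lemma terminal_exists: obtains t where "is_terminal C t"
proof -
  define J :: "(nat, nat) cat" where
    "J = \<lparr>Obj = {}, Mor = {}, Dom = id, Cod = id, Id = id, Comp = (\<lambda>g f. f)\<rparr>"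
  define D :: "(nat, nat, 'o, 'm) ftor" where
    "D = \<lparr>OMap = (\<lambda>k. undefined), MMap = (\<lambda>k. undefined)\<rparr>"
  have "category J" by standard (simp_all add: J_def hom_def)
  moreover have "finite (Obj J)" "finite (Mor J)" "is_functor J C D"
    by (simp_all add: J_def is_functor_def)
  ultimately obtain L l where "is_limit J C D L l"
    using regular unfolding regular_category_def finitely_complete_def by meson
  then have "is_terminal C L"
    by (auto simp: is_limit_def is_cone_def is_terminal_def J_def)
  then show ?thesis by (rule that)
qed

lemma cover_pullback:
  assumes pb: "is_pullback C f g p q" and p: "p \<in> hom C P x" and g: "cover g y z"
  shows "cover p P x"
  using regular pb p g unfolding regular_category_def cover_def by blast

lemma cover_lift:
  assumes e: "cover e x y" and a: "a \<in> hom C w y"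
  obtains w' v a' where "cover v w' w" "a' \<in> hom C w' x" "e \<odot> a' = a \<odot> v"
proof -
  obtain P p q where P: "is_pullback C a e p q" "p \<in> hom C P w" "q \<in> hom C P x" "a \<odot> p = e \<odot> q"
    using pullback_exists[OF a cover_hom[OF e]] by metis
  show ?thesis using that[OF cover_pullback[OF P(1,2) e] P(3) P(4)[symmetric]] .
qed

lemma monoI:
  assumes "m \<in> hom C x y"
    "\<And>w a b. a \<in> hom C w x \<Longrightarrow> b \<in> hom C w x \<Longrightarrow> m \<odot> a = m \<odot> b \<Longrightarrow> a = b"
  shows "is_mono C m"
  using assms homD[OF assms(1)] unfolding is_mono_def by simp

lemma monoD:
  assumes "is_mono C m" "m \<in> hom C x y" "a \<in> hom C w x" "b \<in> hom C w x" "m \<odot> a = m \<odot> b"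
  shows "a = b"
  using assms homD[OF assms(2)] unfolding is_mono_def by blast

text \<open>The image is the quotient by the kernel pair. Two elements of it with the same value in
  \<open>y\<close> lift, on a common cover, to elements of \<open>x\<close> that are related by the kernel pair.\<close>

lemma image_exists:
  assumes f: "f \<in> hom C x y"
  obtains i e m where "cover e x i" "m \<in> hom C i y" "is_mono C m" "m \<odot> e = f"
proof -
  obtain K k1 k2 where K: "is_pullback C f f k1 k2" "k1 \<in> hom C K x" "k2 \<in> hom C K x"
      "f \<odot> k1 = f \<odot> k2"
    using pullback_exists[OF f f] by metis
  obtain e where co: "is_coequaliser C k1 k2 e"
    using regular K(1) unfolding regular_category_def is_kernel_pair_def by blast
  define i where "i = Cod C e"
  have eh: "e \<in> hom C x i"
    using co homD[OF K(2)] by (simp add: is_coequaliser_def hom_def i_def)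
  have e: "cover e x i" using eh co by (auto simp: cover_def is_regular_epi_def)
  note ce = coequaliserD[OF co eh]
  obtain m where m: "m \<in> hom C i y" "m \<odot> e = f" using ce(4)[OF f K(4)] by blast
  have "is_mono C m"
  proof (rule monoI[OF m(1)])
    fix w a b assume a: "a \<in> hom C w i" and b: "b \<in> hom C w i" and eq: "m \<odot> a = m \<odot> b"
    obtain w1 v1 a1 where 1: "cover v1 w1 w" "a1 \<in> hom C w1 x" "e \<odot> a1 = a \<odot> v1"
      using cover_lift[OF e a] .
    note v1 = cover_hom[OF 1(1)]
    obtain w2 v2 b2 where 2: "cover v2 w2 w1" "b2 \<in> hom C w2 x" "e \<odot> b2 = (b \<odot> v1) \<odot> v2"
      using cover_lift[OF e comp_hom[OF v1 b]] .
    note v2 = cover_hom[OF 2(1)]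
    define a2 where "a2 = a1 \<odot> v2"
    have a2: "a2 \<in> hom C w2 x" "e \<odot> a2 = (a \<odot> v1) \<odot> v2"
      using comp_hom[OF v2 1(2)] comp_pre[OF 1(3) v2 1(2) eh] by (simp_all add: a2_def)
    have "f \<odot> a2 = m \<odot> ((a \<odot> v1) \<odot> v2)" "f \<odot> b2 = m \<odot> ((b \<odot> v1) \<odot> v2)"
      using comp_pre[OF m(2) a2(1) eh m(1)] comp_pre[OF m(2) 2(2) eh m(1)] a2 2 by simp_all
    moreover have "m \<odot> ((a \<odot> v1) \<odot> v2) = m \<odot> ((b \<odot> v1) \<odot> v2)"
      using homD[OF a] homD[OF b] homD[OF v1] homD[OF v2] homD[OF m(1)] eq
      by (simp add: comp_assoc_Mor[symmetric])
    ultimately have "f \<odot> a2 = f \<odot> b2" by simp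
    then obtain h where h: "h \<in> hom C w2 K" "k1 \<odot> h = a2" "k2 \<odot> h = b2"
      using pullback_lift[OF K(1-3) a2(1) 2(2)] by metis
    have "e \<odot> a2 = e \<odot> b2"
      using comp_square[OF ce(3) h(1) K(2) eh K(3) eh] h by simp
    then have "(a \<odot> v1) \<odot> v2 = (b \<odot> v1) \<odot> v2" using a2 2 by simp
    then have "a \<odot> v1 = b \<odot> v1"
      by (rule cover_cancel[OF 2(1) comp_hom[OF v1 a] comp_hom[OF v1 b]])
    then show "a = b" by (rule cover_cancel[OF 1(1) a b])
  qed
  then show ?thesis using that[OF e m(1) _ m(2)] by simp
qed

lemma isoI:
  assumes "m \<in> hom C x y" "d \<in> hom C y x" "m \<odot> d = Id C y" "d \<odot> m = Id C x"
  shows "is_iso C m"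
  using assms homD[OF assms(1)] unfolding is_iso_def by auto

lemma mono_split_iso:
  assumes m: "is_mono C m" "m \<in> hom C x y" and d: "d \<in> hom C y x" "m \<odot> d = Id C y"
  shows "is_iso C m"
proof (rule isoI[OF m(2) d])
  have "m \<odot> (d \<odot> m) = m \<odot> Id C x"
    using comp_pre[OF d(2) m(2) d(1) m(2)] comp_id_left[OF m(2)] comp_id_right[OF m(2)] by simp
  then show "d \<odot> m = Id C x"
    by (rule monoD[OF m comp_hom[OF m(2) d(1)] id_hom[OF homD(4)[OF m(2)]]])
qed

lemma cover_if_extremal:
  assumes f: "f \<in> hom C x y"
    and ext: "\<And>i e m. e \<in> hom C x i \<Longrightarrow> m \<in> hom C i y \<Longrightarrow> is_mono C m \<Longrightarrow> m \<odot> e = f \<Longrightarrow> is_iso C m"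
  shows "cover f x y"
proof -
  obtain i e m where m: "cover e x i" "m \<in> hom C i y" "is_mono C m" "m \<odot> e = f"
    using image_exists[OF f] .
  have "is_iso C m" using ext[OF cover_hom[OF m(1)] m(2,3,4)] .
  then show ?thesis using cover_comp_iso[OF m(1,2)] m(4) by simp
qed

text \<open>Regular epimorphisms are strong: since \<open>m\<close> is monic, \<open>e\<close> identifies whatever \<open>f\<close>
  identifies.\<close>

lemma cover_diagonal:
  assumes f: "cover f x y" and e: "e \<in> hom C x i" and m: "m \<in> hom C i z" "is_mono C m"
    and g: "g \<in> hom C y z" and eq: "m \<odot> e = g \<odot> f"
  obtains d where "d \<in> hom C y i" "d \<odot> f = e" "m \<odot> d = g"
proof -
  note fh = cover_hom[OF f]
  have "\<exists>d\<in>hom C y i. d \<odot> f = e"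
  proof (rule cover_factor[OF f e])
    fix w a b assume a: "a \<in> hom C w x" and b: "b \<in> hom C w x" and fab: "f \<odot> a = f \<odot> b"
    have "m \<odot> (e \<odot> a) = m \<odot> (e \<odot> b)"
      using comp_square[OF eq a e m(1) fh g] comp_square[OF eq b e m(1) fh g] fab by simp
    then show "e \<odot> a = e \<odot> b"
      by (rule monoD[OF m(2,1) comp_hom[OF a e] comp_hom[OF b e]])
  qed
  then obtain d where d: "d \<in> hom C y i" "d \<odot> f = e" by blast
  have "(m \<odot> d) \<odot> f = g \<odot> f" using comp_assoc[OF fh d(1) m(1)] d eq by simp
  then have "m \<odot> d = g" by (rule cover_cancel[OF f comp_hom[OF d(1) m(1)] g])
  then show ?thesis using that d by blast
qed

lemma cover_extremal:
  assumes f: "cover f x y" and e: "e \<in> hom C x i" and m: "m \<in> hom C i y" "is_mono C m"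
    and eq: "m \<odot> e = f"
  shows "is_iso C m"
proof -
  note fh = cover_hom[OF f]
  have "m \<odot> e = Id C y \<odot> f" using eq comp_id_left[OF fh] by simp
  then obtain d where "d \<in> hom C y i" "m \<odot> d = Id C y"
    using cover_diagonal[OF f e m id_hom[OF homD(5)[OF fh]]] by metis
  then show ?thesis by (rule mono_split_iso[OF m(2,1)])
qed

text \<open>In a regular category the regular epimorphisms are exactly the arrows that factor through
  no proper subobject. Closure under composition and cancellation of a first factor are easy in
  that form.\<close>

lemma cover_comp:
  assumes f: "cover f x y" and g: "cover g y z"
  shows "cover (g \<odot> f) x z"
proof (rule cover_if_extremal)
  note fh = cover_hom[OF f] and gh = cover_hom[OF g]
  show "g \<odot> f \<in> hom C x z" by (rule comp_hom[OF fh gh])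
  fix i e m
  assume e: "e \<in> hom C x i" and m: "m \<in> hom C i z" "is_mono C m" and eq: "m \<odot> e = g \<odot> f"
  obtain d where "d \<in> hom C y i" "m \<odot> d = g"
    using cover_diagonal[OF f e m gh eq] by metis
  then show "is_iso C m" by (rule cover_extremal[OF g _ m])
qed

lemma cover_right_factor:
  assumes f: "f \<in> hom C x y" and g: "g \<in> hom C y z" and gf: "cover (g \<odot> f) x z"
  shows "cover g y z"
proof (rule cover_if_extremal[OF g])
  fix i e m
  assume e: "e \<in> hom C y i" and m: "m \<in> hom C i z" "is_mono C m" and eq: "m \<odot> e = g"
  show "is_iso C m"
    by (rule cover_extremal[OF gf comp_hom[OF f e] m comp_pre[OF eq f e m(1)]])
qed

lemma product_exists:
  assumes x: "x \<in> Obj C" and y: "y \<in> Obj C"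
  obtains P p q where "p \<in> hom C P x" "q \<in> hom C P y"
    "\<And>w a b. a \<in> hom C w x \<Longrightarrow> b \<in> hom C w y \<Longrightarrow> \<exists>h\<in>hom C w P. p \<odot> h = a \<and> q \<odot> h = b"
    "\<And>w a b. a \<in> hom C w P \<Longrightarrow> b \<in> hom C w P \<Longrightarrow> p \<odot> a = p \<odot> b \<Longrightarrow> q \<odot> a = q \<odot> b \<Longrightarrow> a = b"
proof -
  obtain t where t: "is_terminal C t" by (rule terminal_exists)
  obtain f g where f: "f \<in> hom C x t" and g: "g \<in> hom C y t"
    using t x y unfolding is_terminal_def by blast
  obtain P p q where P: "is_pullback C f g p q" "p \<in> hom C P x" "q \<in> hom C P y"
    using pullback_exists[OF f g] by metis
  show ?thesis
  proof (rule that[OF P(2,3)])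
    fix w a b assume ab: "a \<in> hom C w x" "b \<in> hom C w y"
    have "f \<odot> a = g \<odot> b"
      using t comp_hom[OF ab(1) f] comp_hom[OF ab(2) g] homD[OF ab(1)]
      unfolding is_terminal_def by blast
    then show "\<exists>h\<in>hom C w P. p \<odot> h = a \<and> q \<odot> h = b"
      using pullback_lift[OF P ab] by blast
  next
    fix w a b assume "a \<in> hom C w P" "b \<in> hom C w P" "p \<odot> a = p \<odot> b" "q \<odot> a = q \<odot> b"
    then show "a = b" by (rule pullback_jointly_mono[OF P])
  qed
qed

text \<open>The pairing exhibits an intersection of two kernel relations as a kernel relation, which
  makes it available as an equivalence relation.\<close>

lemma pairing_exists:
  assumes f: "f \<in> hom C x y" and g: "g \<in> hom C x z"
  obtains P k where "k \<in> hom C x P"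
    "\<And>w a b. a \<in> hom C w x \<Longrightarrow> b \<in> hom C w x \<Longrightarrow>
      k \<odot> a = k \<odot> b \<longleftrightarrow> f \<odot> a = f \<odot> b \<and> g \<odot> a = g \<odot> b"
proof -
  obtain P p q where p: "p \<in> hom C P y" and q: "q \<in> hom C P z"
    and pair: "\<And>w a b. a \<in> hom C w y \<Longrightarrow> b \<in> hom C w z \<Longrightarrow> \<exists>h\<in>hom C w P. p \<odot> h = a \<and> q \<odot> h = b"
    and mono: "\<And>w a b. a \<in> hom C w P \<Longrightarrow> b \<in> hom C w P \<Longrightarrow> p \<odot> a = p \<odot> b \<Longrightarrow> q \<odot> a = q \<odot> b \<Longrightarrow> a = b"
    using product_exists[OF homD(5)[OF f] homD(5)[OF g]] by metis
  obtain k where k: "k \<in> hom C x P" "p \<odot> k = f" "q \<odot> k = g" using pair[OF f g] by blast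
  show ?thesis
  proof (rule that[OF k(1)])
    fix w a b assume a: "a \<in> hom C w x" and b: "b \<in> hom C w x"
    have "p \<odot> (k \<odot> a) = f \<odot> a" "q \<odot> (k \<odot> a) = g \<odot> a" "p \<odot> (k \<odot> b) = f \<odot> b" "q \<odot> (k \<odot> b) = g \<odot> b"
      using comp_pre[OF k(2) a k(1) p] comp_pre[OF k(3) a k(1) q]
        comp_pre[OF k(2) b k(1) p] comp_pre[OF k(3) b k(1) q] by simp_all
    then show "k \<odot> a = k \<odot> b \<longleftrightarrow> f \<odot> a = f \<odot> b \<and> g \<odot> a = g \<odot> b"
      using mono[OF comp_hom[OF a k(1)] comp_hom[OF b k(1)]] by metis
  qed
qed

lemma relationI:
  assumes "r1 \<in> hom C r x" "r2 \<in> hom C r y"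
    "\<And>w a b. a \<in> hom C w r \<Longrightarrow> b \<in> hom C w r \<Longrightarrow> r1 \<odot> a = r1 \<odot> b \<Longrightarrow> r2 \<odot> a = r2 \<odot> b \<Longrightarrow> a = b"
  shows "is_relation C x y (r1, r2)"
  using assms homD[OF assms(1)] homD[OF assms(2)] unfolding is_relation_def by simp

text \<open>The image is taken in the product \<open>x \<times> y\<close>.\<close>

lemma span_image_exists:
  assumes r1: "r1 \<in> hom C r x" and r2: "r2 \<in> hom C r y"
  obtains i1 i2 e where "is_relation C x y (i1, i2)" "cover e r (Dom C i1)"
    "i1 \<odot> e = r1" "i2 \<odot> e = r2"
proof -
  obtain P p q where p: "p \<in> hom C P x" and q: "q \<in> hom C P y"
    and pair: "\<And>w a b. a \<in> hom C w x \<Longrightarrow> b \<in> hom C w y \<Longrightarrow> \<exists>h\<in>hom C w P. p \<odot> h = a \<and> q \<odot> h = b"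
    and mono: "\<And>w a b. a \<in> hom C w P \<Longrightarrow> b \<in> hom C w P \<Longrightarrow> p \<odot> a = p \<odot> b \<Longrightarrow> q \<odot> a = q \<odot> b \<Longrightarrow> a = b"
    using product_exists[OF homD(5)[OF r1] homD(5)[OF r2]] by metis
  obtain k where k: "k \<in> hom C r P" "p \<odot> k = r1" "q \<odot> k = r2" using pair[OF r1 r2] by blast
  obtain i e m where m: "cover e r i" "m \<in> hom C i P" "is_mono C m" "m \<odot> e = k"
    using image_exists[OF k(1)] .
  note eh = cover_hom[OF m(1)]
  have i: "p \<odot> m \<in> hom C i x" "q \<odot> m \<in> hom C i y"
    using comp_hom[OF m(2) p] comp_hom[OF m(2) q] .
  have rel: "is_relation C x y (p \<odot> m, q \<odot> m)"
  proof (rule relationI[OF i])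
    fix w a b assume a: "a \<in> hom C w i" and b: "b \<in> hom C w i"
      and eq: "(p \<odot> m) \<odot> a = (p \<odot> m) \<odot> b" "(q \<odot> m) \<odot> a = (q \<odot> m) \<odot> b"
    have "m \<odot> a = m \<odot> b"
      using mono[OF comp_hom[OF a m(2)] comp_hom[OF b m(2)]] eq
        comp_assoc[OF a m(2) p] comp_assoc[OF a m(2) q] comp_assoc[OF b m(2) p] comp_assoc[OF b m(2) q]
      by simp
    then show "a = b" by (rule monoD[OF m(3,2) a b])
  qed
  have "cover e r (Dom C (p \<odot> m))" using m(1) homD[OF i(1)] by simp
  then show ?thesis
    using that[OF rel] comp_assoc[OF eh m(2) p] comp_assoc[OF eh m(2) q] m k by simp
qed

section \<open>Relations and the Goursat condition, elementwise\<close>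

lemma relatedI:
  assumes "is_relation C x y (r1, r2)" "h \<in> hom C w (Dom C r1)"
  shows "related (r1, r2) (r1 \<odot> h) (r2 \<odot> h)"
  using assms(2) homD[OF comp_hom[OF assms(2) relation_hom(1)[OF assms(1)]]]
  by (auto simp: related_def)

lemma relatedE:
  assumes "related (r1, r2) a b" "a \<in> hom C w x"
  obtains h where "h \<in> hom C w (Dom C r1)" "r1 \<odot> h = a" "r2 \<odot> h = b"
  using assms homD[OF assms(2)] by (auto simp: related_def)

text \<open>The structure maps of an internal equivalence relation come from applying the elementwise
  laws to generic elements: the identity of \<open>x\<close>, the pair of legs, and the two projections of the
  object of consecutive pairs.\<close>

lemma equiv_relationI:
  assumes rel: "is_relation C x x (r1, r2)"
    and refl: "related (r1, r2) (Id C x) (Id C x)"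
    and sym: "\<And>w a b. a \<in> hom C w x \<Longrightarrow> b \<in> hom C w x \<Longrightarrow>
      related (r1, r2) a b \<Longrightarrow> related (r1, r2) b a"
    and trans: "\<And>w a b c. a \<in> hom C w x \<Longrightarrow> b \<in> hom C w x \<Longrightarrow> c \<in> hom C w x \<Longrightarrow>
      related (r1, r2) a b \<Longrightarrow> related (r1, r2) b c \<Longrightarrow> related (r1, r2) a c"
  shows "is_equiv_relation C x (r1, r2)"
proof -
  note r = relation_hom[OF rel]
  have x: "x \<in> Obj C" using homD(5)[OF r(1)] .
  have 1: "\<exists>d\<in>hom C x (Dom C r1). r1 \<odot> d = Id C x \<and> r2 \<odot> d = Id C x"
    using relatedE[OF refl id_hom[OF x]] by metis
  have "related (r1, r2) r1 r2"
    using relatedI[OF rel id_hom[OF homD(4)[OF r(1)]]] comp_id_right[OF r(1)] comp_id_right[OF r(2)]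
    by simp
  then have 2: "\<exists>s\<in>hom C (Dom C r1) (Dom C r1). r1 \<odot> s = r2 \<and> r2 \<odot> s = r1"
    using relatedE[OF sym[OF r] r(2)] by metis
  have 3: "\<exists>t\<in>hom C (Dom C p) (Dom C r1). r1 \<odot> t = r1 \<odot> p \<and> r2 \<odot> t = r2 \<odot> q"
    if pb: "is_pullback C r2 r1 p q" for p q
  proof -
    obtain P where P: "p \<in> hom C P (Dom C r1)" "q \<in> hom C P (Dom C r1)" "r2 \<odot> p = r1 \<odot> q"
      using pullback_hom[OF pb r(2) r(1)] .
    have "related (r1, r2) (r1 \<odot> p) (r2 \<odot> p)" "related (r1, r2) (r2 \<odot> p) (r2 \<odot> q)"
      using relatedI[OF rel P(1)] relatedI[OF rel P(2)] P(3) by simp_all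
    then have "related (r1, r2) (r1 \<odot> p) (r2 \<odot> q)"
      by (rule trans[OF comp_hom[OF P(1) r(1)] comp_hom[OF P(1) r(2)] comp_hom[OF P(2) r(2)]])
    then show ?thesis
      using relatedE[OF _ comp_hom[OF P(1) r(1)]] homD[OF P(1)] by metis
  qed
  show ?thesis using rel 1 2 3 unfolding is_equiv_relation_def by simp
qed

lemma related_trans:
  assumes R: "is_equiv_relation C x R"
    and a: "a \<in> hom C w x" and b: "b \<in> hom C w x"
    and ab: "related R a b" and bc: "related R b c"
  shows "related R a c"
proof -
  obtain r1 r2 where R2: "R = (r1, r2)" by force
  have rel: "is_relation C x x (r1, r2)" using R by (simp add: is_equiv_relation_def R2)
  note r = relation_hom[OF rel]
  obtain h where h: "h \<in> hom C w (Dom C r1)" "r1 \<odot> h = a" "r2 \<odot> h = b"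
    using relatedE[OF ab[unfolded R2] a] .
  obtain k where k: "k \<in> hom C w (Dom C r1)" "r1 \<odot> k = b" "r2 \<odot> k = c"
    using relatedE[OF bc[unfolded R2] b] .
  obtain P p q where P: "is_pullback C r2 r1 p q" "p \<in> hom C P (Dom C r1)" "q \<in> hom C P (Dom C r1)"
    using pullback_exists[OF r(2) r(1)] by metis
  have "\<exists>t\<in>hom C P (Dom C r1). r1 \<odot> t = r1 \<odot> p \<and> r2 \<odot> t = r2 \<odot> q"
    using R P(1) homD[OF P(2)] unfolding is_equiv_relation_def R2 by auto
  then obtain t where t: "t \<in> hom C P (Dom C r1)" "r1 \<odot> t = r1 \<odot> p" "r2 \<odot> t = r2 \<odot> q"
    by blast
  obtain l where l: "l \<in> hom C w P" "p \<odot> l = h" "q \<odot> l = k"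
    using pullback_lift[OF P h(1) k(1)] h k by metis
  have "r1 \<odot> (t \<odot> l) = a" "r2 \<odot> (t \<odot> l) = c"
    using comp_square[OF t(2) l(1) t(1) r(1) P(2) r(1)]
      comp_square[OF t(3) l(1) t(1) r(2) P(3) r(2)] h k l by simp_all
  then show ?thesis
    using relatedI[OF rel comp_hom[OF l(1) t(1)]] R2 by simp
qed

lemma kernel_pair_equiv_relation:
  assumes pb: "is_pullback C f f k1 k2" and f: "f \<in> hom C x y"
  shows "is_equiv_relation C x (k1, k2)"
    and "\<And>w a b. a \<in> hom C w x \<Longrightarrow> b \<in> hom C w x \<Longrightarrow> related (k1, k2) a b \<longleftrightarrow> f \<odot> a = f \<odot> b"
proof -
  obtain K where K: "k1 \<in> hom C K x" "k2 \<in> hom C K x" "f \<odot> k1 = f \<odot> k2"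
    using pullback_hom[OF pb f f] .
  note dK = homD[OF K(1)]
  have rel: "is_relation C x x (k1, k2)"
    by (rule relationI[OF K(1,2)]) (rule pullback_jointly_mono[OF pb K(1,2)])
  show iff: "related (k1, k2) a b \<longleftrightarrow> f \<odot> a = f \<odot> b"
    if a: "a \<in> hom C w x" and b: "b \<in> hom C w x" for w a b
  proof
    assume "related (k1, k2) a b"
    then obtain h where h: "h \<in> hom C w K" "k1 \<odot> h = a" "k2 \<odot> h = b"
      using relatedE[OF _ a] dK by metis
    then show "f \<odot> a = f \<odot> b" using comp_square[OF K(3) h(1) K(1) f K(2) f] by simp
  next
    assume "f \<odot> a = f \<odot> b"
    then obtain h where h: "h \<in> hom C w K" "k1 \<odot> h = a" "k2 \<odot> h = b"
      using pullback_lift[OF pb K(1,2) a b] by metis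
    then show "related (k1, k2) a b" using relatedI[OF rel, of h w] dK by simp
  qed
  have "related (k1, k2) (Id C x) (Id C x)"
    using iff[OF id_hom id_hom] homD(4)[OF f] by simp
  then show "is_equiv_relation C x (k1, k2)"
    by (rule equiv_relationI[OF rel]) (simp_all add: iff)
qed

lemma kernel_relation_exists:
  assumes f: "f \<in> hom C x y"
  obtains R where "is_equiv_relation C x R"
    "\<And>w a b. a \<in> hom C w x \<Longrightarrow> b \<in> hom C w x \<Longrightarrow> related R a b \<longleftrightarrow> f \<odot> a = f \<odot> b"
proof -
  obtain k1 k2 where "is_pullback C f f k1 k2" using pullback_exists[OF f f] by metis
  from kernel_pair_equiv_relation[OF this f] show ?thesis by (rule that)
qed

lemma rel_comp_exists:
  assumes R: "is_relation C x y R" and S: "is_relation C y z S"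
  obtains T where "is_rel_comp C S R T"
proof -
  obtain r1 r2 where R2: "R = (r1, r2)" by force
  obtain s1 s2 where S2: "S = (s1, s2)" by force
  note r = relation_hom[OF R[unfolded R2]] and s = relation_hom[OF S[unfolded S2]]
  obtain P p q where P: "is_pullback C r2 s1 p q" "p \<in> hom C P (Dom C r1)" "q \<in> hom C P (Dom C s1)"
    using pullback_exists[OF r(2) s(1)] by metis
  obtain t1 t2 e where T: "is_relation C x z (t1, t2)" "cover e P (Dom C t1)"
      "t1 \<odot> e = r1 \<odot> p" "t2 \<odot> e = s2 \<odot> q"
    using span_image_exists[OF comp_hom[OF P(2) r(1)] comp_hom[OF P(3) s(2)]] .
  have "is_rel_comp C S R (t1, t2)"
    unfolding is_rel_comp_def R2 S2
    using T P homD[OF P(2)] homD[OF r(1)] homD[OF s(2)] by (auto simp: cover_def)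
  then show ?thesis by (rule that)
qed

text \<open>A pair in the composite lifts along the regular epimorphism that defines the image to a
  pair of consecutive elements; conversely, membership in the composite may be checked on the cover
  where the middle element exists.\<close>

lemma rel_comp_related:
  assumes comp: "is_rel_comp C S R T" and R: "is_relation C x y R" and S: "is_relation C y z S"
  shows "is_relation C x z T"
    and "\<And>w a c. a \<in> hom C w x \<Longrightarrow> c \<in> hom C w z \<Longrightarrow> related T a c \<longleftrightarrow>
      (\<exists>w' v b. cover v w' w \<and> b \<in> hom C w' y \<and> related R (a \<odot> v) b \<and> related S b (c \<odot> v))"
proof -
  obtain r1 r2 where R2: "R = (r1, r2)" by force
  obtain s1 s2 where S2: "S = (s1, s2)" by force
  obtain t1 t2 where T2: "T = (t1, t2)" by force
  note R' = R[unfolded R2] and S' = S[unfolded S2]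
  note r = relation_hom[OF R'] and s = relation_hom[OF S']
  obtain p q e where T: "is_relation C (Cod C r1) (Cod C s2) (t1, t2)"
      and pb: "is_pullback C r2 s1 p q"
      and e: "is_regular_epi C e" "e \<in> hom C (Dom C p) (Dom C t1)"
        "t1 \<odot> e = r1 \<odot> p" "t2 \<odot> e = s2 \<odot> q"
    using comp unfolding is_rel_comp_def R2 S2 T2 by auto
  obtain P where P: "p \<in> hom C P (Dom C r1)" "q \<in> hom C P (Dom C s1)" "r2 \<odot> p = s1 \<odot> q"
    using pullback_hom[OF pb r(2) s(1)] .
  have T': "is_relation C x z (t1, t2)" using T homD[OF r(1)] homD[OF s(2)] by simp
  then show Trel: "is_relation C x z T" by (simp add: T2)
  note t = relation_hom[OF T']
  have ec: "cover e P (Dom C t1)" using e homD[OF P(1)] by (simp add: cover_def)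
  note eh = cover_hom[OF ec]
  fix w a c assume a: "a \<in> hom C w x" and c: "c \<in> hom C w z"
  show "related T a c \<longleftrightarrow>
      (\<exists>w' v b. cover v w' w \<and> b \<in> hom C w' y \<and> related R (a \<odot> v) b \<and> related S b (c \<odot> v))"
  proof
    assume "related T a c"
    then obtain h where h: "h \<in> hom C w (Dom C t1)" "t1 \<odot> h = a" "t2 \<odot> h = c"
      using relatedE[OF _ a] T2 by metis
    obtain w' v h' where v: "cover v w' w" "h' \<in> hom C w' P" "e \<odot> h' = h \<odot> v"
      using cover_lift[OF ec h(1)] .
    note vh = cover_hom[OF v(1)]
    have ph: "p \<odot> h' \<in> hom C w' (Dom C r1)" "q \<odot> h' \<in> hom C w' (Dom C s1)"
      using comp_hom[OF v(2) P(1)] comp_hom[OF v(2) P(2)] .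
    have "r1 \<odot> (p \<odot> h') = t1 \<odot> (e \<odot> h')" "s2 \<odot> (q \<odot> h') = t2 \<odot> (e \<odot> h')"
      using comp_square[OF e(3) v(2) eh t(1) P(1) r(1)] comp_square[OF e(4) v(2) eh t(2) P(2) s(2)]
      by simp_all
    then have 1: "r1 \<odot> (p \<odot> h') = a \<odot> v" "s2 \<odot> (q \<odot> h') = c \<odot> v"
      using v(3) comp_pre[OF h(2) vh h(1) t(1)] comp_pre[OF h(3) vh h(1) t(2)] by simp_all
    have 2: "r2 \<odot> (p \<odot> h') = s1 \<odot> (q \<odot> h')"
      by (rule comp_square[OF P(3) v(2) P(1) r(2) P(2) s(1)])
    have "related R (a \<odot> v) (r2 \<odot> p \<odot> h')" "related S (r2 \<odot> p \<odot> h') (c \<odot> v)"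
      using relatedI[OF R' ph(1)] relatedI[OF S' ph(2)] 1 2 by (simp_all add: R2 S2)
    then show "\<exists>w' v b. cover v w' w \<and> b \<in> hom C w' y \<and> related R (a \<odot> v) b \<and> related S b (c \<odot> v)"
      using v(1) comp_hom[OF ph(1) r(2)] by blast
  next
    assume "\<exists>w' v b. cover v w' w \<and> b \<in> hom C w' y \<and> related R (a \<odot> v) b \<and> related S b (c \<odot> v)"
    then obtain w' v b where v: "cover v w' w" and b: "b \<in> hom C w' y"
      and ab: "related R (a \<odot> v) b" and bc: "related S b (c \<odot> v)" by blast
    note vh = cover_hom[OF v]
    obtain h where h: "h \<in> hom C w' (Dom C r1)" "r1 \<odot> h = a \<odot> v" "r2 \<odot> h = b"
      using relatedE[OF ab[unfolded R2] comp_hom[OF vh a]] .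
    obtain k where k: "k \<in> hom C w' (Dom C s1)" "s1 \<odot> k = b" "s2 \<odot> k = c \<odot> v"
      using relatedE[OF bc[unfolded S2] b] .
    obtain l where l: "l \<in> hom C w' P" "p \<odot> l = h" "q \<odot> l = k"
      using pullback_lift[OF pb P(1,2) h(1) k(1)] h k by metis
    have "t1 \<odot> (e \<odot> l) = a \<odot> v" "t2 \<odot> (e \<odot> l) = c \<odot> v"
      using comp_square[OF e(3) l(1) eh t(1) P(1) r(1)] comp_square[OF e(4) l(1) eh t(2) P(2) s(2)]
        h k l by simp_all
    then have "related T (a \<odot> v) (c \<odot> v)"
      using relatedI[OF T' comp_hom[OF l(1) eh]] T2 by simp
    then show "related T a c" by (rule related_descent[OF Trel a c v])
  qed
qed

lemma rel_comp3_exists: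
  assumes "is_relation C x x R1" "is_relation C x x R2" "is_relation C x x R3"
  obtains T where "is_rel_comp3 C R3 R2 R1 T"
proof -
  obtain Q where Q: "is_rel_comp C R2 R1 Q" using rel_comp_exists[OF assms(1,2)] .
  obtain T where "is_rel_comp C R3 Q T"
    using rel_comp_exists[OF rel_comp_related(1)[OF Q assms(1,2)] assms(3)] .
  then show ?thesis using that Q unfolding is_rel_comp3_def by blast
qed

lemma rel_comp3_related:
  assumes comp: "is_rel_comp3 C R3 R2 R1 T"
    and R: "is_relation C x x R1" "is_relation C x x R2" "is_relation C x x R3"
  shows "is_relation C x x T"
    and "\<And>w a d. a \<in> hom C w x \<Longrightarrow> d \<in> hom C w x \<Longrightarrow> related T a d \<longleftrightarrow>
      (\<exists>w' v b c. cover v w' w \<and> b \<in> hom C w' x \<and> c \<in> hom C w' x \<and>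
        related R1 (a \<odot> v) b \<and> related R2 b c \<and> related R3 c (d \<odot> v))"
proof -
  obtain Q where Q: "is_rel_comp C R2 R1 Q" and T: "is_rel_comp C R3 Q T"
    using comp by (auto simp: is_rel_comp3_def)
  note Qrel = rel_comp_related(1)[OF Q R(1,2)]
  note iffQ = rel_comp_related(2)[OF Q R(1,2)] and iffT = rel_comp_related(2)[OF T Qrel R(3)]
  show Trel: "is_relation C x x T" by (rule rel_comp_related(1)[OF T Qrel R(3)])
  fix w a d assume a: "a \<in> hom C w x" and d: "d \<in> hom C w x"
  show "related T a d \<longleftrightarrow>
      (\<exists>w' v b c. cover v w' w \<and> b \<in> hom C w' x \<and> c \<in> hom C w' x \<and>
        related R1 (a \<odot> v) b \<and> related R2 b c \<and> related R3 c (d \<odot> v))"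
  proof
    assume "related T a d"
    then obtain w1 v1 c where 1: "cover v1 w1 w" "c \<in> hom C w1 x" "related Q (a \<odot> v1) c"
        "related R3 c (d \<odot> v1)"
      using iffT[OF a d] by blast
    note v1 = cover_hom[OF 1(1)]
    obtain w2 v2 b where 2: "cover v2 w2 w1" "b \<in> hom C w2 x" "related R1 ((a \<odot> v1) \<odot> v2) b"
        "related R2 b (c \<odot> v2)"
      using iffQ[OF comp_hom[OF v1 a] 1(2)] 1(3) by blast
    note v2 = cover_hom[OF 2(1)]
    have "related R3 (c \<odot> v2) ((d \<odot> v1) \<odot> v2)"
      by (rule related_precomp[OF R(3) 1(2) v2 1(4)])
    then show "\<exists>w' v b c. cover v w' w \<and> b \<in> hom C w' x \<and> c \<in> hom C w' x \<and>
        related R1 (a \<odot> v) b \<and> related R2 b c \<and> related R3 c (d \<odot> v)"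
      using cover_comp[OF 2(1) 1(1)] 2 comp_hom[OF v2 1(2)]
        comp_assoc[OF v2 v1 a] comp_assoc[OF v2 v1 d] by metis
  next
    assume "\<exists>w' v b c. cover v w' w \<and> b \<in> hom C w' x \<and> c \<in> hom C w' x \<and>
        related R1 (a \<odot> v) b \<and> related R2 b c \<and> related R3 c (d \<odot> v)"
    then obtain w' v b c where v: "cover v w' w" and b: "b \<in> hom C w' x" and c: "c \<in> hom C w' x"
      and rel: "related R1 (a \<odot> v) b" "related R2 b c" "related R3 c (d \<odot> v)" by blast
    note vh = cover_hom[OF v]
    note w' = homD(4)[OF vh]
    have "related Q (a \<odot> v) c"
      using iffQ[OF comp_hom[OF vh a] c] cover_Id[OF w'] b rel
        comp_id_right[OF comp_hom[OF vh a]] comp_id_right[OF c] by metis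
    then show "related T a d" using iffT[OF a d] v c rel by blast
  qed
qed

end

locale goursat_cat = regular_cat C for C :: "('o, 'm) cat" (structure) +
  assumes goursat: "goursat C"
begin

text \<open>The inclusion of \<open>R S R\<close> in \<open>S R S\<close>, read on elements.\<close>

lemma goursat_swap:
  assumes R: "is_equiv_relation C x R" and S: "is_equiv_relation C x S"
    and a: "a \<in> hom C w x" and d: "d \<in> hom C w x" and v: "cover v w' w"
    and b: "b \<in> hom C w' x" and c: "c \<in> hom C w' x"
    and rel: "related R (a \<odot> v) b" "related S b c" "related R c (d \<odot> v)"
  obtains w'' v' b' c' where "cover v' w'' w" "b' \<in> hom C w'' x" "c' \<in> hom C w'' x"
    "related S (a \<odot> v') b'" "related R b' c'" "related S c' (d \<odot> v')"
proof -
  have R': "is_relation C x x R" and S': "is_relation C x x S"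
    using R S by (simp_all add: is_equiv_relation_def)
  obtain T where T: "is_rel_comp3 C R S R T" using rel_comp3_exists[OF R' S' R'] .
  obtain T' where T': "is_rel_comp3 C S R S T'" using rel_comp3_exists[OF S' R' S'] .
  have eq: "rel_eq C T T'" using goursat R S T T' unfolding goursat_def by blast
  have "related T a d" using rel_comp3_related(2)[OF T R' S' R' a d] v b c rel by blast
  obtain t1 t2 where T2: "T = (t1, t2)" by force
  obtain t1' t2' where T2': "T' = (t1', t2')" by force
  note Trel = rel_comp3_related(1)[OF T R' S' R', unfolded T2]
  note Trel' = rel_comp3_related(1)[OF T' S' R' S', unfolded T2']
  note t = relation_hom[OF Trel] and t' = relation_hom[OF Trel']
  obtain i where i: "i \<in> hom C (Dom C t1) (Dom C t1')" "t1' \<odot> i = t1" "t2' \<odot> i = t2"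
    using eq unfolding rel_eq_def T2 T2' by auto
  obtain h where h: "h \<in> hom C w (Dom C t1)" "t1 \<odot> h = a" "t2 \<odot> h = d"
    using relatedE[OF \<open>related T a d\<close>[unfolded T2] a] .
  have "t1' \<odot> (i \<odot> h) = a" "t2' \<odot> (i \<odot> h) = d"
    using comp_pre[OF i(2) h(1) i(1) t'(1)] comp_pre[OF i(3) h(1) i(1) t'(2)] h by simp_all
  then have "related T' a d" using relatedI[OF Trel' comp_hom[OF h(1) i(1)]] T2' by simp
  then show ?thesis using that rel_comp3_related(2)[OF T' S' R' S' a d] by blast
qed

text \<open>Let \<open>S\<close> be the kernel relation of \<open>s\<close>. This is the modular law
  \<open>S \<and> (R \<or> Q) = (S \<and> R) \<or> Q\<close> for \<open>Q \<le> S\<close> when \<open>S \<and> R\<close> is trivial. Replace the chain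
  \<open>R Q R\<close> from \<open>a\<close> to \<open>d\<close> by a chain \<open>a Q m R n Q d\<close>. As \<open>Q\<close> lies in \<open>S\<close> and \<open>a S d\<close>,
  also \<open>m S n\<close>, hence \<open>m = n\<close>, and \<open>a Q d\<close>.\<close>

lemma modular_shift:
  assumes R: "is_equiv_relation C x R" and Q: "is_equiv_relation C x Q" and s: "s \<in> hom C x z"
    and Qs: "\<And>w a b. a \<in> hom C w x \<Longrightarrow> b \<in> hom C w x \<Longrightarrow> related Q a b \<Longrightarrow> s \<odot> a = s \<odot> b"
    and Rs: "\<And>w a b. a \<in> hom C w x \<Longrightarrow> b \<in> hom C w x \<Longrightarrow> related R a b \<Longrightarrow> s \<odot> a = s \<odot> b \<Longrightarrow> a = b"
    and a: "a \<in> hom C w x" and d: "d \<in> hom C w x" and sad: "s \<odot> a = s \<odot> d" and v: "cover v w' w"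
    and b: "b \<in> hom C w' x" and c: "c \<in> hom C w' x"
    and rel: "related R (a \<odot> v) b" "related Q b c" "related R c (d \<odot> v)"
  shows "related Q a d"
proof -
  obtain w'' v' m n where v': "cover v' w'' w" and m: "m \<in> hom C w'' x" and n: "n \<in> hom C w'' x"
    and mn: "related Q (a \<odot> v') m" "related R m n" "related Q n (d \<odot> v')"
    using goursat_swap[OF R Q a d v b c rel] .
  note vh = cover_hom[OF v']
  note av = comp_hom[OF vh a] and dv = comp_hom[OF vh d]
  have "s \<odot> m = s \<odot> (a \<odot> v')" "s \<odot> n = s \<odot> (d \<odot> v')"
    using Qs[OF av m mn(1)] Qs[OF n dv mn(3)] by simp_all
  then have "s \<odot> m = s \<odot> n" using comp_square[OF sad vh a s d s] by simp
  then have "m = n" by (rule Rs[OF m n mn(2)])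
  then have "related Q (a \<odot> v') (d \<odot> v')"
    using related_trans[OF Q av m mn(1)] mn(3) by simp
  then show ?thesis
    using related_descent[OF _ a d v'] Q by (simp add: is_equiv_relation_def)
qed

text \<open>Only transitivity of the image is in question. With \<open>R\<close> the kernel relation of \<open>f\<close>, two
  consecutive steps of the image come from a chain \<open>S R S\<close> in \<open>x\<close>. By the Goursat condition it
  can be replaced by a chain \<open>R S R\<close>, whose outer steps vanish under \<open>f\<close>.\<close>

lemma image_equiv_relation:
  assumes f: "cover f x y" and S: "is_equiv_relation C x S"
  obtains I where "is_equiv_relation C y I"
    "\<And>w a b. a \<in> hom C w y \<Longrightarrow> b \<in> hom C w y \<Longrightarrow> related I a b \<longleftrightarrow>
      (\<exists>w' v a' b'. cover v w' w \<and> a' \<in> hom C w' x \<and> b' \<in> hom C w' x \<and>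
        f \<odot> a' = a \<odot> v \<and> f \<odot> b' = b \<odot> v \<and> related S a' b')"
proof -
  obtain s1 s2 where S2: "S = (s1, s2)" by force
  have Srel: "is_relation C x x (s1, s2)" using S by (simp add: is_equiv_relation_def S2)
  note s = relation_hom[OF Srel] and fh = cover_hom[OF f]
  obtain i1 i2 e where I: "is_relation C y y (i1, i2)" and e: "cover e (Dom C s1) (Dom C i1)"
      "i1 \<odot> e = f \<odot> s1" "i2 \<odot> e = f \<odot> s2"
    using span_image_exists[OF comp_hom[OF s(1) fh] comp_hom[OF s(2) fh]] .
  note i = relation_hom[OF I] and eh = cover_hom[OF e(1)]
  have iff: "related (i1, i2) a b \<longleftrightarrow>
      (\<exists>w' v a' b'. cover v w' w \<and> a' \<in> hom C w' x \<and> b' \<in> hom C w' x \<and>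
        f \<odot> a' = a \<odot> v \<and> f \<odot> b' = b \<odot> v \<and> related S a' b')"
    if a: "a \<in> hom C w y" and b: "b \<in> hom C w y" for w a b
  proof
    assume "related (i1, i2) a b"
    then obtain h where h: "h \<in> hom C w (Dom C i1)" "i1 \<odot> h = a" "i2 \<odot> h = b"
      using relatedE[OF _ a] by metis
    obtain w' v h' where v: "cover v w' w" "h' \<in> hom C w' (Dom C s1)" "e \<odot> h' = h \<odot> v"
      using cover_lift[OF e(1) h(1)] .
    note vh = cover_hom[OF v(1)]
    have "f \<odot> (s1 \<odot> h') = a \<odot> v" "f \<odot> (s2 \<odot> h') = b \<odot> v"
      using comp_square[OF e(2) v(2) eh i(1) s(1) fh] comp_square[OF e(3) v(2) eh i(2) s(2) fh]
        comp_pre[OF h(2) vh h(1) i(1)] comp_pre[OF h(3) vh h(1) i(2)] v(3) by simp_all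
    then show "\<exists>w' v a' b'. cover v w' w \<and> a' \<in> hom C w' x \<and> b' \<in> hom C w' x \<and>
        f \<odot> a' = a \<odot> v \<and> f \<odot> b' = b \<odot> v \<and> related S a' b'"
      using v(1) comp_hom[OF v(2) s(1)] comp_hom[OF v(2) s(2)] relatedI[OF Srel v(2)] S2 by blast
  next
    assume "\<exists>w' v a' b'. cover v w' w \<and> a' \<in> hom C w' x \<and> b' \<in> hom C w' x \<and>
        f \<odot> a' = a \<odot> v \<and> f \<odot> b' = b \<odot> v \<and> related S a' b'"
    then obtain w' v a' b' where v: "cover v w' w" and a': "a' \<in> hom C w' x"
      and eq: "f \<odot> a' = a \<odot> v" "f \<odot> b' = b \<odot> v" and ab: "related S a' b'" by blast
    obtain h where h: "h \<in> hom C w' (Dom C s1)" "s1 \<odot> h = a'" "s2 \<odot> h = b'"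
      using relatedE[OF ab[unfolded S2] a'] .
    have "i1 \<odot> (e \<odot> h) = a \<odot> v" "i2 \<odot> (e \<odot> h) = b \<odot> v"
      using comp_square[OF e(2) h(1) eh i(1) s(1) fh] comp_square[OF e(3) h(1) eh i(2) s(2) fh] h eq
      by simp_all
    then have "related (i1, i2) (a \<odot> v) (b \<odot> v)"
      using relatedI[OF I comp_hom[OF h(1) eh]] by simp
    then show "related (i1, i2) a b" by (rule related_descent[OF I a b v])
  qed
  obtain R where R: "is_equiv_relation C x R"
    and Riff: "\<And>w a b. a \<in> hom C w x \<Longrightarrow> b \<in> hom C w x \<Longrightarrow> related R a b \<longleftrightarrow> f \<odot> a = f \<odot> b"
    using kernel_relation_exists[OF fh] by metis
  have "is_equiv_relation C y (i1, i2)"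
  proof (rule equiv_relationI[OF I])
    have y: "y \<in> Obj C" using homD(5)[OF fh] .
    have "\<exists>w' v a' b'. cover v w' y \<and> a' \<in> hom C w' x \<and> b' \<in> hom C w' x \<and>
        f \<odot> a' = Id C y \<odot> v \<and> f \<odot> b' = Id C y \<odot> v \<and> related S a' b'"
      using f id_hom[OF homD(4)[OF fh]] related_refl[OF S id_hom[OF homD(4)[OF fh]]]
        comp_id_right[OF fh] comp_id_left[OF fh] by metis
    then show "related (i1, i2) (Id C y) (Id C y)"
      using iff[OF id_hom[OF y] id_hom[OF y]] by blast
  next
    fix w a b assume a: "a \<in> hom C w y" and b: "b \<in> hom C w y" and ab: "related (i1, i2) a b"
    show "related (i1, i2) b a"
      using ab unfolding iff[OF a b] iff[OF b a] using related_sym[OF S] by metis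
  next
    fix w a b c assume a: "a \<in> hom C w y" and b: "b \<in> hom C w y" and c: "c \<in> hom C w y"
      and ab: "related (i1, i2) a b" and bc: "related (i1, i2) b c"
    obtain w1 v1 a1 b1 where 1: "cover v1 w1 w" "a1 \<in> hom C w1 x" "b1 \<in> hom C w1 x"
        "f \<odot> a1 = a \<odot> v1" "f \<odot> b1 = b \<odot> v1" "related S a1 b1"
      using ab unfolding iff[OF a b] by metis
    note v1 = cover_hom[OF 1(1)]
    have "related (i1, i2) (b \<odot> v1) (c \<odot> v1)" by (rule related_precomp[OF I b v1 bc])
    then obtain w2 v2 b2 c2 where 2: "cover v2 w2 w1" "b2 \<in> hom C w2 x" "c2 \<in> hom C w2 x"
        "f \<odot> b2 = (b \<odot> v1) \<odot> v2" "f \<odot> c2 = (c \<odot> v1) \<odot> v2" "related S b2 c2"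
      unfolding iff[OF comp_hom[OF v1 b] comp_hom[OF v1 c]] by metis
    note v2 = cover_hom[OF 2(1)]
    \<comment> \<open>pulled back to \<open>w2\<close>: \<open>a1 S b1 R b2 S c2\<close>\<close>
    have a1: "a1 \<odot> v2 \<in> hom C w2 x" and b1: "b1 \<odot> v2 \<in> hom C w2 x"
      using comp_hom[OF v2 1(2)] comp_hom[OF v2 1(3)] .
    have "related S ((a1 \<odot> v2) \<odot> Id C w2) (b1 \<odot> v2)"
      using related_precomp[OF Srel[folded S2] 1(2) v2 1(6)] comp_id_right[OF a1] by simp
    moreover have "related R (b1 \<odot> v2) b2"
      using Riff[OF b1 2(2)] comp_pre[OF 1(5) v2 1(3) fh] 2(4) by simp
    moreover have "related S b2 (c2 \<odot> Id C w2)" using 2(6) comp_id_right[OF 2(3)] by simp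
    ultimately obtain w3 v3 m n where 3: "cover v3 w3 w2" "m \<in> hom C w3 x" "n \<in> hom C w3 x"
        "related R ((a1 \<odot> v2) \<odot> v3) m" "related S m n" "related R n (c2 \<odot> v3)"
      using goursat_swap[OF S R a1 2(3) cover_Id[OF homD(4)[OF v2]] b1 2(2)] by metis
    note v3 = cover_hom[OF 3(1)]
    define v where "v = v1 \<odot> (v2 \<odot> v3)"
    have v: "cover v w3 w" using cover_comp[OF cover_comp[OF 3(1) 2(1)] 1(1)] by (simp add: v_def)
    have "f \<odot> m = f \<odot> ((a1 \<odot> v2) \<odot> v3)"
      using Riff[OF comp_hom[OF v3 a1] 3(2)] 3(4) by simp
    also have "\<dots> = (f \<odot> a1) \<odot> (v2 \<odot> v3)"
      using homD[OF 1(2)] homD[OF v2] homD[OF v3] homD[OF fh] by (simp add: comp_assoc_Mor)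
    also have "\<dots> = a \<odot> v"
      using homD[OF a] homD[OF v1] homD[OF v2] homD[OF v3] 1(4) by (simp add: comp_assoc_Mor v_def)
    finally have m: "f \<odot> m = a \<odot> v" .
    have "f \<odot> n = f \<odot> (c2 \<odot> v3)"
      using Riff[OF 3(3) comp_hom[OF v3 2(3)]] 3(6) by simp
    also have "\<dots> = (f \<odot> c2) \<odot> v3" using comp_assoc[OF v3 2(3) fh] by simp
    also have "\<dots> = c \<odot> v"
      using homD[OF c] homD[OF v1] homD[OF v2] homD[OF v3] 2(5) by (simp add: comp_assoc_Mor v_def)
    finally have n: "f \<odot> n = c \<odot> v" .
    show "related (i1, i2) a c" using iff[OF a c] v 3 m n by blast
  qed
  then show ?thesis using iff by (rule that)
qed

end

section \<open>The reflection onto a Birkhoff subcategory\<close>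

locale birkhoff = goursat_cat C for C :: "('o, 'm) cat" (structure) +
  fixes B :: "'o set" and b :: "('o, 'm, 'o, 'm) ftor" and \<eta> :: "'o \<Rightarrow> 'm"
  assumes birkhoff: "birkhoff_subcategory C B"
    and reflector: "is_reflector C B b \<eta>"
begin

lemma reflector_functor: "is_functor C (full_subcat C B) b"
  using reflector unfolding is_reflector_def by blast

lemma reflection_in_B:
  assumes "x \<in> Obj C" shows "OMap b x \<in> B"
proof -
  have "OMap b x \<in> Obj (full_subcat C B)"
    using reflector_functor assms unfolding is_functor_def by blast
  then show ?thesis by (simp add: full_subcat_def)
qed

lemma unit_hom:
  assumes "x \<in> Obj C" shows "\<eta> x \<in> hom C x (OMap b x)"
  using reflector assms unfolding is_reflector_def by blast

lemma map_hom:
  assumes "f \<in> hom C x y" shows "MMap b f \<in> hom C (OMap b x) (OMap b y)"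
proof -
  have "MMap b f \<in> hom (full_subcat C B) (OMap b (Dom C f)) (OMap b (Cod C f))"
    using reflector_functor homD(1)[OF assms] unfolding is_functor_def by blast
  then show ?thesis using homD[OF assms] by (simp add: hom_def full_subcat_def)
qed

lemma map_comp:
  assumes "f \<in> hom C x y" "g \<in> hom C y z"
  shows "MMap b (g \<odot> f) = MMap b g \<odot> MMap b f"
proof -
  have "Cod C f = Dom C g" using homD[OF assms(1)] homD[OF assms(2)] by simp
  then have "MMap b (g \<odot> f) = MMap b g \<odot>\<^bsub>full_subcat C B\<^esub> MMap b f"
    using reflector_functor homD(1)[OF assms(1)] homD(1)[OF assms(2)] unfolding is_functor_def by blast
  then show ?thesis by (simp add: full_subcat_def)
qed

lemma unit_natural:
  assumes "f \<in> hom C x y" shows "MMap b f \<odot> \<eta> x = \<eta> y \<odot> f"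
proof -
  have "\<forall>f\<in>Mor C. MMap b f \<odot> \<eta> (Dom C f) = \<eta> (Cod C f) \<odot> f"
    using reflector unfolding is_reflector_def by blast
  then show ?thesis using homD[OF assms] by auto
qed

lemma unit_universal:
  assumes "f \<in> hom C x y" "y \<in> B"
  shows "\<exists>!g. g \<in> hom C (OMap b x) y \<and> g \<odot> \<eta> x = f"
proof -
  have "\<forall>x\<in>Obj C. \<forall>y\<in>B. \<forall>f\<in>hom C x y. \<exists>!g. g \<in> hom C (OMap b x) y \<and> g \<odot> \<eta> x = f"
    using reflector unfolding is_reflector_def by blast
  then show ?thesis using assms homD(4)[OF assms(1)] by blast
qed

lemma unit_factor:
  assumes "f \<in> hom C x y" "y \<in> B"
  obtains g where "g \<in> hom C (OMap b x) y" "g \<odot> \<eta> x = f"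
  using unit_universal[OF assms] by blast

lemma unit_cancel:
  assumes x: "x \<in> Obj C" and g: "g \<in> hom C (OMap b x) y" and g': "g' \<in> hom C (OMap b x) y"
    and y: "y \<in> B" and eq: "g \<odot> \<eta> x = g' \<odot> \<eta> x"
  shows "g = g'"
  using unit_universal[OF comp_hom[OF unit_hom[OF x] g] y] g g' eq by metis

lemma unit_eq_natural:
  assumes f: "f \<in> hom C x y" and a: "a \<in> hom C w x" and c: "c \<in> hom C w x"
    and eq: "\<eta> x \<odot> a = \<eta> x \<odot> c"
  shows "\<eta> y \<odot> (f \<odot> a) = \<eta> y \<odot> (f \<odot> c)"
  using comp_square[OF unit_natural[OF f] a unit_hom[OF homD(4)[OF f]] map_hom[OF f] f unit_hom[OF homD(5)[OF f]]]
    comp_square[OF unit_natural[OF f] c unit_hom[OF homD(4)[OF f]] map_hom[OF f] f unit_hom[OF homD(5)[OF f]]]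
    eq by simp

lemma quotient_in_B: "cover f x y \<Longrightarrow> x \<in> B \<Longrightarrow> y \<in> B"
  using birkhoff homD[OF cover_hom, of f x y] unfolding birkhoff_subcategory_def cover_def by blast

lemma subobject_in_B: "is_mono C m \<Longrightarrow> m \<in> hom C x y \<Longrightarrow> y \<in> B \<Longrightarrow> x \<in> B"
  using birkhoff homD[of m x y] unfolding birkhoff_subcategory_def by blast

text \<open>The image of \<open>\<eta>\<^sub>x\<close> is a subobject of \<open>b x\<close>, hence in \<open>B\<close>; by universality of \<open>\<eta>\<^sub>x\<close> it
  is all of \<open>b x\<close>.\<close>

lemma unit_cover:
  assumes x: "x \<in> Obj C" shows "cover (\<eta> x) x (OMap b x)"
proof (rule cover_if_extremal[OF unit_hom[OF x]])
  fix i e m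
  assume e: "e \<in> hom C x i" and m: "m \<in> hom C i (OMap b x)" "is_mono C m" and eq: "m \<odot> e = \<eta> x"
  note bx = reflection_in_B[OF x] and h = unit_hom[OF x]
  obtain t where t: "t \<in> hom C (OMap b x) i" "t \<odot> \<eta> x = e"
    using unit_factor[OF e subobject_in_B[OF m(2,1) bx]] .
  have "(m \<odot> t) \<odot> \<eta> x = Id C (OMap b x) \<odot> \<eta> x"
    using comp_assoc[OF h t(1) m(1)] t(2) eq comp_id_left[OF h] by simp
  then have "m \<odot> t = Id C (OMap b x)"
    by (rule unit_cancel[OF x comp_hom[OF t(1) m(1)] id_hom[OF homD(5)[OF h]] bx])
  then show "is_iso C m" by (rule mono_split_iso[OF m(2,1) t(1)])
qed

text \<open>The image \<open>I\<close> in \<open>y\<close> of the kernel relation of \<open>\<eta>\<^sub>x\<close> is an equivalence relation, so by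
  exactness it is the kernel relation of its quotient \<open>q : y \<rightarrow> z\<close>. As \<open>q \<odot> f\<close> factors through
  \<open>\<eta>\<^sub>x\<close>, the object \<open>z\<close> is a quotient of \<open>b x\<close> and so lies in \<open>B\<close>. Hence \<open>q\<close> factors
  through \<open>\<eta>\<^sub>y\<close>, and elements that \<open>\<eta>\<^sub>y\<close> identifies are related by \<open>I\<close>.\<close>

lemma unit_kernel_lift:
  assumes f: "cover f x y" and a: "a \<in> hom C w y" and c: "c \<in> hom C w y"
    and eq: "\<eta> y \<odot> a = \<eta> y \<odot> c"
  obtains w' v a' c' where "cover v w' w" "a' \<in> hom C w' x" "c' \<in> hom C w' x"
    "f \<odot> a' = a \<odot> v" "f \<odot> c' = c \<odot> v" "\<eta> x \<odot> a' = \<eta> x \<odot> c'"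
proof -
  note fh = cover_hom[OF f]
  note x = homD(4)[OF fh] and y = homD(5)[OF fh]
  note hx = unit_hom[OF x] and hy = unit_hom[OF y]
  obtain S where S: "is_equiv_relation C x S"
    and Siff: "\<And>w a c. a \<in> hom C w x \<Longrightarrow> c \<in> hom C w x \<Longrightarrow> related S a c \<longleftrightarrow> \<eta> x \<odot> a = \<eta> x \<odot> c"
    by (rule kernel_relation_exists[OF hx], rule that, assumption, simp only:)
  obtain I where I: "is_equiv_relation C y I"
    and Iiff: "\<And>w a c. a \<in> hom C w y \<Longrightarrow> c \<in> hom C w y \<Longrightarrow> related I a c \<longleftrightarrow>
      (\<exists>w' v a' c'. cover v w' w \<and> a' \<in> hom C w' x \<and> c' \<in> hom C w' x \<and>
        f \<odot> a' = a \<odot> v \<and> f \<odot> c' = c \<odot> v \<and> related S a' c')"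
    by (rule image_equiv_relation[OF f S], rule that, assumption, simp only:)
  obtain i1 i2 where I2: "I = (i1, i2)" by force
  have Irel: "is_relation C y y (i1, i2)" using I by (simp add: is_equiv_relation_def I2)
  note i = relation_hom[OF Irel]
  obtain q0 where q0: "is_pullback C q0 q0 i1 i2"
    using goursat I unfolding goursat_def barr_exact_def is_kernel_pair_def I2 by blast
  obtain q where co: "is_coequaliser C i1 i2 q"
    using regular q0 unfolding regular_category_def is_kernel_pair_def by blast
  define z where "z = Cod C q"
  have qh: "q \<in> hom C y z" using co homD[OF i(1)] by (simp add: is_coequaliser_def hom_def z_def)
  have q: "cover q y z" using qh co by (auto simp: cover_def is_regular_epi_def)
  note cq = coequaliserD[OF co qh]
  define z0 where "z0 = Cod C q0"
  have q0h: "q0 \<in> hom C y z0" "q0 \<odot> i1 = q0 \<odot> i2"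
  proof -
    have "q0 \<in> Mor C \<and> Cod C i1 = Dom C q0 \<and> q0 \<odot> i1 = q0 \<odot> i2"
      using q0 unfolding is_pullback_def by blast
    then show "q0 \<in> hom C y z0" "q0 \<odot> i1 = q0 \<odot> i2"
      using homD[OF i(1)] by (simp_all add: hom_def z0_def)
  qed
  obtain m where m: "m \<in> hom C z z0" "m \<odot> q = q0" using cq(4)[OF q0h] by blast
  have ker_q: "related I a c \<longleftrightarrow> q \<odot> a = q \<odot> c"
    if a: "a \<in> hom C w y" and c: "c \<in> hom C w y" for w a c
  proof
    assume "related I a c"
    then obtain h where h: "h \<in> hom C w (Dom C i1)" "i1 \<odot> h = a" "i2 \<odot> h = c"
      using relatedE[OF _ a] I2 by metis
    then show "q \<odot> a = q \<odot> c" using comp_square[OF cq(3) h(1) i(1) qh i(2) qh] by simp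
  next
    assume "q \<odot> a = q \<odot> c"
    then have "q0 \<odot> a = q0 \<odot> c"
      using comp_pre[OF m(2) a qh m(1)] comp_pre[OF m(2) c qh m(1)] by simp
    then show "related I a c"
      using kernel_pair_equiv_relation(2)[OF q0 q0h(1) a c] I2 by simp
  qed
  have "\<exists>t\<in>hom C (OMap b x) z. t \<odot> \<eta> x = q \<odot> f"
  proof (rule cover_factor[OF unit_cover[OF x] comp_hom[OF fh qh]])
    fix w a c assume a: "a \<in> hom C w x" and c: "c \<in> hom C w x" and eq: "\<eta> x \<odot> a = \<eta> x \<odot> c"
    note fa = comp_hom[OF a fh] and fc = comp_hom[OF c fh] and w = homD(4)[OF a]
    have "related S a c" using Siff[OF a c] eq by simp
    then have "\<exists>w' v a' c'. cover v w' w \<and> a' \<in> hom C w' x \<and> c' \<in> hom C w' x \<and>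
        f \<odot> a' = (f \<odot> a) \<odot> v \<and> f \<odot> c' = (f \<odot> c) \<odot> v \<and> related S a' c'"
      using cover_Id[OF w] a c comp_id_right[OF fa] comp_id_right[OF fc]
      by (intro exI[of _ w] exI[of _ "Id C w"] exI[of _ a] exI[of _ c]) simp
    then have "related I (f \<odot> a) (f \<odot> c)" unfolding Iiff[OF fa fc] .
    then have "q \<odot> (f \<odot> a) = q \<odot> (f \<odot> c)" using ker_q[OF fa fc] by simp
    then show "(q \<odot> f) \<odot> a = (q \<odot> f) \<odot> c"
      using comp_assoc[OF a fh qh] comp_assoc[OF c fh qh] by simp
  qed
  then obtain t where t: "t \<in> hom C (OMap b x) z" "t \<odot> \<eta> x = q \<odot> f" by blast
  have "cover t (OMap b x) z"
    using cover_right_factor[OF hx t(1)] cover_comp[OF f q] t(2) by simp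
  then have "z \<in> B" using quotient_in_B reflection_in_B[OF x] by blast
  then obtain s where s: "s \<in> hom C (OMap b y) z" "s \<odot> \<eta> y = q" using unit_factor[OF qh] by blast
  have "q \<odot> a = q \<odot> c"
    using comp_pre[OF s(2) a hy s(1)] comp_pre[OF s(2) c hy s(1)] eq by simp
  then have "related I a c" using ker_q[OF a c] by simp
  then obtain w' v a' c' where v: "cover v w' w" "a' \<in> hom C w' x" "c' \<in> hom C w' x"
      "f \<odot> a' = a \<odot> v" "f \<odot> c' = c \<odot> v" and rel: "related S a' c'"
    unfolding Iiff[OF a c] by blast
  show ?thesis using that[OF v] rel Siff[OF v(2,3)] by simp
qed

section \<open>Trivial and central extensions\<close>

lemma trivial_extensionD:
  assumes "trivial_extension C b \<eta> f" "f \<in> hom C x y"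
  shows "cover f x y" "is_pullback C (MMap b f) (\<eta> y) (\<eta> x) f"
  using assms homD[OF assms(2)] by (simp_all add: trivial_extension_def cover_def extension_def)

lemma trivial_extensionI:
  assumes "cover f x y" "is_pullback C (MMap b f) (\<eta> y) (\<eta> x) f"
  shows "trivial_extension C b \<eta> f"
  using assms homD[OF cover_hom[OF assms(1)]]
  by (simp add: trivial_extension_def cover_def extension_def)

text \<open>The uniqueness half of the pullback property that makes an extension trivial; this half
  is what uniqueness of lifts from a perfect object rests on.\<close>

definition unit_separated :: "'m \<Rightarrow> bool" where
  "unit_separated f \<longleftrightarrow> (\<forall>w. \<forall>a\<in>hom C w (Dom C f). \<forall>c\<in>hom C w (Dom C f).
     f \<odot> a = f \<odot> c \<longrightarrow> \<eta> (Dom C f) \<odot> a = \<eta> (Dom C f) \<odot> c \<longrightarrow> a = c)"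

lemma unit_separatedI:
  assumes "f \<in> hom C x y"
    "\<And>w a c. a \<in> hom C w x \<Longrightarrow> c \<in> hom C w x \<Longrightarrow> f \<odot> a = f \<odot> c \<Longrightarrow> \<eta> x \<odot> a = \<eta> x \<odot> c \<Longrightarrow> a = c"
  shows "unit_separated f"
  using assms(2) homD[OF assms(1)] unfolding unit_separated_def by simp

lemma unit_separatedD:
  assumes "unit_separated f" "f \<in> hom C x y" "a \<in> hom C w x" "c \<in> hom C w x"
    "f \<odot> a = f \<odot> c" "\<eta> x \<odot> a = \<eta> x \<odot> c"
  shows "a = c"
  using assms homD[OF assms(2)] unfolding unit_separated_def by blast

lemma trivial_unit_separated:
  assumes "trivial_extension C b \<eta> f" "f \<in> hom C x y"
  shows "unit_separated f"
proof (rule unit_separatedI[OF assms(2)])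
  note pb = trivial_extensionD(2)[OF assms]
  show "a = c" if "a \<in> hom C w x" "c \<in> hom C w x" "f \<odot> a = f \<odot> c" "\<eta> x \<odot> a = \<eta> x \<odot> c" for w a c
    using pullback_jointly_mono[OF pb unit_hom[OF homD(4)[OF assms(2)]] assms(2) that(1,2,4,3)] .
qed

text \<open>An element of \<open>P\<close> is determined by its components in \<open>z\<close> and \<open>x\<close>, and the triviality
  of \<open>f\<close> produces the component in \<open>x\<close> from data in \<open>b P\<close> and \<open>z\<close>. To see that this has the
  prescribed reflection, it must be shown that \<open>b p\<close> and \<open>b q\<close> are jointly monic. Let \<open>a\<close> and
  \<open>d\<close> in \<open>P\<close> have components with equal reflections. The elements \<open>p a\<close> and \<open>p d\<close> are
  identified by \<open>\<eta>\<^sub>z\<close>, so by \<open>unit_kernel_lift\<close> there is a chain \<open>R E R\<close> from \<open>a\<close> to \<open>d\<close>, where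
  \<open>R\<close> and \<open>E\<close> are the kernel relations of \<open>p\<close> and of \<open>\<eta>\<^sub>P\<close>. The kernel relation of
  \<open>\<eta>\<^sub>x \<odot> q\<close> contains \<open>E\<close>, relates \<open>a\<close> and \<open>d\<close>, and meets \<open>R\<close> trivially since \<open>f\<close> is
  trivial. Now \<open>modular_shift\<close> gives \<open>a E d\<close>.\<close>

lemma trivial_pullback:
  assumes triv: "trivial_extension C b \<eta> f" and f: "f \<in> hom C x y" and g: "g \<in> hom C z y"
    and pb: "is_pullback C g f p q" and p: "p \<in> hom C P z" and q: "q \<in> hom C P x"
  shows "trivial_extension C b \<eta> p"
proof -
  note fc = trivial_extensionD(1)[OF triv f] and fpb = trivial_extensionD(2)[OF triv f]
  have pc: "cover p P z" by (rule cover_pullback[OF pb p fc])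
  have comm: "g \<odot> p = f \<odot> q" using pb by (simp add: is_pullback_def)
  note objs = homD(4)[OF f] homD(5)[OF f] homD(4)[OF g] homD(4)[OF p]
  note hx = unit_hom[OF objs(1)] and hy = unit_hom[OF objs(2)] and hz = unit_hom[OF objs(3)]
    and hP = unit_hom[OF objs(4)]
  note bf = map_hom[OF f] and bg = map_hom[OF g] and bp = map_hom[OF p] and bq = map_hom[OF q]
  have bcomm: "MMap b g \<odot> MMap b p = MMap b f \<odot> MMap b q"
    using map_comp[OF p g] map_comp[OF q f] comm by simp
  \<comment> \<open>joint monicity of \<open>b p\<close> and \<open>b q\<close>, first for elements that come from \<open>P\<close>\<close>
  have lift_eq: "\<eta> P \<odot> a = \<eta> P \<odot> d"
    if a: "a \<in> hom C w P" and d: "d \<in> hom C w P"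
      and eqz: "\<eta> z \<odot> (p \<odot> a) = \<eta> z \<odot> (p \<odot> d)" and eqx: "\<eta> x \<odot> (q \<odot> a) = \<eta> x \<odot> (q \<odot> d)"
    for w a d
  proof -
    obtain R where R: "is_equiv_relation C P R"
      and Riff: "\<And>w a c. a \<in> hom C w P \<Longrightarrow> c \<in> hom C w P \<Longrightarrow> related R a c \<longleftrightarrow> p \<odot> a = p \<odot> c"
      by (rule kernel_relation_exists[OF p], rule that, assumption, simp only:)
    obtain E where E: "is_equiv_relation C P E"
      and Eiff: "\<And>w a c. a \<in> hom C w P \<Longrightarrow> c \<in> hom C w P \<Longrightarrow> related E a c \<longleftrightarrow> \<eta> P \<odot> a = \<eta> P \<odot> c"
      by (rule kernel_relation_exists[OF hP], rule that, assumption, simp only:)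
    obtain w' v m n where v: "cover v w' w" and m: "m \<in> hom C w' P" and n: "n \<in> hom C w' P"
      and mn: "p \<odot> m = (p \<odot> a) \<odot> v" "p \<odot> n = (p \<odot> d) \<odot> v" "\<eta> P \<odot> m = \<eta> P \<odot> n"
      using unit_kernel_lift[OF pc comp_hom[OF a p] comp_hom[OF d p] eqz] .
    note vh = cover_hom[OF v]
    have s: "\<eta> x \<odot> q \<in> hom C P (OMap b x)" by (rule comp_hom[OF q hx])
    have s_assoc: "(\<eta> x \<odot> q) \<odot> k = \<eta> x \<odot> (q \<odot> k)" if "k \<in> hom C w P" for w k
      by (rule comp_assoc[OF that q hx])
    have "related E a d"
    proof (rule modular_shift[OF R E s _ _ a d _ v m n])
      fix w k l assume k: "k \<in> hom C w P" and l: "l \<in> hom C w P"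
      show "(\<eta> x \<odot> q) \<odot> k = (\<eta> x \<odot> q) \<odot> l" if "related E k l"
        using that Eiff[OF k l] unit_eq_natural[OF q k l] s_assoc[OF k] s_assoc[OF l] by simp
      show "k = l" if kl: "related R k l" "(\<eta> x \<odot> q) \<odot> k = (\<eta> x \<odot> q) \<odot> l"
      proof -
        have pkl: "p \<odot> k = p \<odot> l" using kl Riff[OF k l] by simp
        then have "f \<odot> (q \<odot> k) = f \<odot> (q \<odot> l)"
          using comp_square[OF comm k p g q f] comp_square[OF comm l p g q f] by simp
        moreover have "\<eta> x \<odot> (q \<odot> k) = \<eta> x \<odot> (q \<odot> l)" using kl s_assoc[OF k] s_assoc[OF l] by simp
        ultimately have "q \<odot> k = q \<odot> l"
          using unit_separatedD[OF trivial_unit_separated[OF triv f] f comp_hom[OF k q] comp_hom[OF l q]]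
          by simp
        with pkl show ?thesis by (rule pullback_jointly_mono[OF pb p q k l])
      qed
    next
      show "(\<eta> x \<odot> q) \<odot> a = (\<eta> x \<odot> q) \<odot> d" using eqx s_assoc[OF a] s_assoc[OF d] by simp
      show "related R (a \<odot> v) m"
        using Riff[OF comp_hom[OF vh a] m] mn comp_assoc[OF vh a p] by simp
      show "related E m n" using Eiff[OF m n] mn by simp
      show "related R n (d \<odot> v)"
        using Riff[OF n comp_hom[OF vh d]] mn comp_assoc[OF vh d p] by simp
    qed
    then show ?thesis using Eiff[OF a d] by simp
  qed
  \<comment> \<open>on a cover, every element of \<open>b P\<close> comes from \<open>P\<close>\<close>
  have bmono: "s = t"
    if s: "s \<in> hom C w (OMap b P)" and t: "t \<in> hom C w (OMap b P)"
      and eqp: "MMap b p \<odot> s = MMap b p \<odot> t" and eqq: "MMap b q \<odot> s = MMap b q \<odot> t" for w s t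
  proof -
    note hPc = unit_cover[OF objs(4)]
    obtain w1 v1 a where 1: "cover v1 w1 w" "a \<in> hom C w1 P" "\<eta> P \<odot> a = s \<odot> v1"
      using cover_lift[OF hPc s] .
    note v1 = cover_hom[OF 1(1)]
    obtain w2 v2 d where 2: "cover v2 w2 w1" "d \<in> hom C w2 P" "\<eta> P \<odot> d = (t \<odot> v1) \<odot> v2"
      using cover_lift[OF hPc comp_hom[OF v1 t]] .
    note v2 = cover_hom[OF 2(1)]
    have a: "a \<odot> v2 \<in> hom C w2 P" "\<eta> P \<odot> (a \<odot> v2) = (s \<odot> v1) \<odot> v2"
      using comp_hom[OF v2 1(2)] comp_pre[OF 1(3) v2 1(2) hP] by simp_all
    have refl_eq: "\<eta> u \<odot> (r \<odot> (a \<odot> v2)) = \<eta> u \<odot> (r \<odot> d)"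
      if r: "r \<in> hom C P u" and eq: "MMap b r \<odot> s = MMap b r \<odot> t" for r u
    proof -
      note hu = unit_hom[OF homD(5)[OF r]]
      have "\<eta> u \<odot> (r \<odot> (a \<odot> v2)) = MMap b r \<odot> (s \<odot> v1) \<odot> v2"
        using comp_square[OF unit_natural[OF r] a(1) hP map_hom[OF r] r hu] a(2) by simp
      also have "\<dots> = MMap b r \<odot> (t \<odot> v1) \<odot> v2"
        using homD[OF s] homD[OF t] homD[OF v1] homD[OF v2] homD[OF map_hom[OF r]] eq
        by (simp add: comp_assoc_Mor[symmetric])
      also have "\<dots> = \<eta> u \<odot> (r \<odot> d)"
        using comp_square[OF unit_natural[OF r] 2(2) hP map_hom[OF r] r hu] 2(3) by simp
      finally show ?thesis .
    qed
    have "\<eta> P \<odot> (a \<odot> v2) = \<eta> P \<odot> d"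
      by (rule lift_eq[OF a(1) 2(2) refl_eq[OF p eqp] refl_eq[OF q eqq]])
    then have "(s \<odot> v1) \<odot> v2 = (t \<odot> v1) \<odot> v2" using a 2 by simp
    then have "s \<odot> v1 = t \<odot> v1"
      by (rule cover_cancel[OF 2(1) comp_hom[OF v1 s] comp_hom[OF v1 t]])
    then show "s = t" by (rule cover_cancel[OF 1(1) s t])
  qed
  have "is_pullback C (MMap b p) (\<eta> z) (\<eta> P) p"
  proof (rule pullbackI[OF bp hz hP p unit_natural[OF p]])
    fix w s a assume s: "s \<in> hom C w (OMap b P)" and a: "a \<in> hom C w z"
      and eq: "MMap b p \<odot> s = \<eta> z \<odot> a"
    have "MMap b f \<odot> (MMap b q \<odot> s) = MMap b g \<odot> (MMap b p \<odot> s)"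
      using comp_square[OF bcomm s bp bg bq bf] by simp
    also have "\<dots> = \<eta> y \<odot> (g \<odot> a)"
      using comp_square[OF unit_natural[OF g] a hz bg g hy] eq by simp
    finally obtain \<xi> where \<xi>: "\<xi> \<in> hom C w x" "\<eta> x \<odot> \<xi> = MMap b q \<odot> s" "f \<odot> \<xi> = g \<odot> a"
      using pullback_lift[OF fpb hx f comp_hom[OF s bq] comp_hom[OF a g]] by metis
    obtain h where h: "h \<in> hom C w P" "p \<odot> h = a" "q \<odot> h = \<xi>"
      using pullback_lift[OF pb p q a \<xi>(1)] \<xi>(3) by metis
    have "MMap b p \<odot> (\<eta> P \<odot> h) = MMap b p \<odot> s"
      using comp_square[OF unit_natural[OF p] h(1) hP bp p hz] h eq by simp
    moreover have "MMap b q \<odot> (\<eta> P \<odot> h) = MMap b q \<odot> s"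
      using comp_square[OF unit_natural[OF q] h(1) hP bq q hx] h \<xi> by simp
    ultimately have "\<eta> P \<odot> h = s" by (rule bmono[OF comp_hom[OF h(1) hP] s])
    then show "\<exists>h\<in>hom C w P. \<eta> P \<odot> h = s \<and> p \<odot> h = a" using h by blast
  next
    fix w h k assume h: "h \<in> hom C w P" and k: "k \<in> hom C w P"
      and eq: "\<eta> P \<odot> h = \<eta> P \<odot> k" "p \<odot> h = p \<odot> k"
    have "f \<odot> (q \<odot> h) = f \<odot> (q \<odot> k)"
      using comp_square[OF comm h p g q f] comp_square[OF comm k p g q f] eq by simp
    then have "q \<odot> h = q \<odot> k"
      using unit_separatedD[OF trivial_unit_separated[OF triv f] f comp_hom[OF h q] comp_hom[OF k q]]
        unit_eq_natural[OF q h k eq(1)] by simp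
    with eq(2) show "h = k" by (rule pullback_jointly_mono[OF pb p q h k])
  qed
  then show ?thesis by (rule trivial_extensionI[OF pc])
qed

lemma central_extensionE:
  assumes "central_extension C b \<eta> f" "f \<in> hom C x y"
  obtains g p q c E where "cover f x y" "cover g c y" "is_pullback C g f p q"
    "p \<in> hom C E c" "q \<in> hom C E x" "trivial_extension C b \<eta> p"
proof -
  note F = homD[OF assms(2)]
  have f: "cover f x y" using assms by (simp add: central_extension_def extension_def cover_def)
  obtain g p q where g: "extension C g" "Cod C g = Cod C f" and pb: "is_pullback C g f p q"
    and triv: "trivial_extension C b \<eta> p"
    using assms(1) unfolding central_extension_def by blast
  have "g \<in> Mor C" using pb unfolding is_pullback_def by blast
  then have gh: "g \<in> hom C (Dom C g) y" using g F by (simp add: hom_def)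
  then have gc: "cover g (Dom C g) y" using g by (simp add: cover_def extension_def)
  obtain E where "p \<in> hom C E (Dom C g)" "q \<in> hom C E x"
    using pullback_hom[OF pb gh assms(2)] .
  then show ?thesis using that[OF f gc pb _ _ triv] by blast
qed

lemma central_extensionI:
  assumes "cover f x y" "cover g c y" "is_pullback C g f p q" "trivial_extension C b \<eta> p"
  shows "central_extension C b \<eta> f"
proof -
  have "extension C f" "extension C g" "Cod C g = Cod C f"
    using assms homD[OF cover_hom[OF assms(1)]] homD[OF cover_hom[OF assms(2)]]
    by (simp_all add: extension_def cover_def)
  then show ?thesis using assms(3,4) unfolding central_extension_def by blast
qed

lemma trivial_central:
  assumes triv: "trivial_extension C b \<eta> f" and f: "f \<in> hom C x y"
  shows "central_extension C b \<eta> f"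
proof -
  note x = homD(4)[OF f] and y = homD(5)[OF f]
  have "is_pullback C (Id C y) f f (Id C x)"
  proof (rule pullbackI[OF id_hom[OF y] f f id_hom[OF x]])
    show "Id C y \<odot> f = f \<odot> Id C x" using comp_id_left[OF f] comp_id_right[OF f] by simp
    fix w a c assume "a \<in> hom C w y" "c \<in> hom C w x" "Id C y \<odot> a = f \<odot> c"
    then show "\<exists>h\<in>hom C w x. f \<odot> h = a \<and> Id C x \<odot> h = c"
      using comp_id_left[of a w y] comp_id_left[of c w x] by auto
  next
    fix w a c assume "a \<in> hom C w x" "c \<in> hom C w x" "Id C x \<odot> a = Id C x \<odot> c"
    then show "a = c" using comp_id_left[of a w x] comp_id_left[of c w x] by simp
  qed
  then show ?thesis
    using central_extensionI[OF trivial_extensionD(1)[OF triv f] cover_Id[OF y] _ triv] by blast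
qed

text \<open>If \<open>g\<close> is an extension along which \<open>f\<close> becomes trivial, pull \<open>g\<close> back along \<open>a\<close> to
  obtain \<open>g'\<close>. The pullback of \<open>p\<close> along \<open>g'\<close> is also a pullback of the trivial extension
  obtained from \<open>f\<close>.\<close>

lemma central_pullback:
  assumes cen: "central_extension C b \<eta> f" and f: "f \<in> hom C x y" and a: "a \<in> hom C z y"
    and pb: "is_pullback C a f p q" and p: "p \<in> hom C P z" and q: "q \<in> hom C P x"
  shows "central_extension C b \<eta> p"
proof -
  obtain g p1 q1 c E where fc: "cover f x y" and g: "cover g c y" and pb1: "is_pullback C g f p1 q1"
    and p1: "p1 \<in> hom C E c" and q1: "q1 \<in> hom C E x" and triv: "trivial_extension C b \<eta> p1"
    using central_extensionE[OF cen f] .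
  note gh = cover_hom[OF g]
  obtain D g' a' where pbg: "is_pullback C a g g' a'" and g': "g' \<in> hom C D z"
    and a': "a' \<in> hom C D c" and comm: "a \<odot> g' = g \<odot> a'"
    using pullback_exists[OF a gh] .
  obtain F p2 q2 where pb2: "is_pullback C g' p p2 q2" and p2: "p2 \<in> hom C F D"
    and q2: "q2 \<in> hom C F P" and comm2: "g' \<odot> p2 = p \<odot> q2"
    using pullback_exists[OF g' p] .
  have comm0: "a \<odot> p = f \<odot> q" and comm1: "g \<odot> p1 = f \<odot> q1"
    using pb pb1 unfolding is_pullback_def by blast+
  note a'p2 = comp_hom[OF p2 a'] and qq2 = comp_hom[OF q2 q]
  have "g \<odot> (a' \<odot> p2) = a \<odot> (g' \<odot> p2)" using comp_square[OF comm p2 g' a a' gh] by simp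
  also have "\<dots> = f \<odot> (q \<odot> q2)" using comp_square[OF comm0 q2 p a q f] comm2 by simp
  finally obtain r where r: "r \<in> hom C F E" "p1 \<odot> r = a' \<odot> p2" "q1 \<odot> r = q \<odot> q2"
    using pullback_lift[OF pb1 p1 q1 a'p2 qq2] by metis
  have "is_pullback C a' p1 p2 r"
  proof (rule pullbackI[OF a' p1 p2 r(1)])
    show "a' \<odot> p2 = p1 \<odot> r" using r by simp
    fix w s t assume s: "s \<in> hom C w D" and t: "t \<in> hom C w E" and eq: "a' \<odot> s = p1 \<odot> t"
    have "a \<odot> (g' \<odot> s) = g \<odot> (a' \<odot> s)" by (rule comp_square[OF comm s g' a a' gh])
    also have "\<dots> = f \<odot> (q1 \<odot> t)" using comp_square[OF comm1 t p1 gh q1 f] eq by simp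
    finally obtain l where l: "l \<in> hom C w P" "p \<odot> l = g' \<odot> s" "q \<odot> l = q1 \<odot> t"
      using pullback_lift[OF pb p q comp_hom[OF s g'] comp_hom[OF t q1]] by metis
    obtain h where h: "h \<in> hom C w F" "p2 \<odot> h = s" "q2 \<odot> h = l"
      using pullback_lift[OF pb2 p2 q2 s l(1)] l(2) by metis
    have "p1 \<odot> (r \<odot> h) = p1 \<odot> t"
      using comp_square[OF r(2) h(1) r(1) p1 p2 a'] h eq by simp
    moreover have "q1 \<odot> (r \<odot> h) = q1 \<odot> t"
      using comp_square[OF r(3) h(1) r(1) q1 q2 q] h l by simp
    ultimately have "r \<odot> h = t"
      by (rule pullback_jointly_mono[OF pb1 p1 q1 comp_hom[OF h(1) r(1)] t])
    then show "\<exists>h\<in>hom C w F. p2 \<odot> h = s \<and> r \<odot> h = t" using h by blast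
  next
    fix w s t assume s: "s \<in> hom C w F" and t: "t \<in> hom C w F"
      and eq: "p2 \<odot> s = p2 \<odot> t" "r \<odot> s = r \<odot> t"
    have "p \<odot> (q2 \<odot> s) = p \<odot> (q2 \<odot> t)"
      using comp_square[OF comm2 s p2 g' q2 p] comp_square[OF comm2 t p2 g' q2 p] eq by simp
    moreover have "q \<odot> (q2 \<odot> s) = q \<odot> (q2 \<odot> t)"
      using comp_square[OF r(3) s r(1) q1 q2 q] comp_square[OF r(3) t r(1) q1 q2 q] eq by simp
    ultimately have "q2 \<odot> s = q2 \<odot> t"
      by (rule pullback_jointly_mono[OF pb p q comp_hom[OF s q2] comp_hom[OF t q2]])
    with eq(1) show "s = t" by (rule pullback_jointly_mono[OF pb2 p2 q2 s t])
  qed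
  then have "trivial_extension C b \<eta> p2"
    by (rule trivial_pullback[OF triv p1 a' _ p2 r(1)])
  then show ?thesis
    by (rule central_extensionI[OF cover_pullback[OF pb p fc] cover_pullback[OF pbg g' g] pb2])
qed

text \<open>Let \<open>a\<close> and \<open>d\<close> in \<open>x\<close> lie over the same element of \<open>y\<close> and have the same reflection;
  lift them to \<open>a'\<close> and \<open>d'\<close> in \<open>E\<close> with the same reflection. Let \<open>e\<close> in \<open>E\<close> lie over \<open>p d'\<close>
  and be mapped to \<open>a\<close> by \<open>q\<close>, and let \<open>m\<close> and \<open>n\<close> be the values at \<open>p a'\<close> and \<open>p d'\<close> of the
  section of \<open>p\<close> induced by \<open>s\<close>. Then \<open>a'\<close>, \<open>m\<close>, \<open>n\<close> and \<open>e\<close> form a parallelogram: \<open>p\<close>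
  identifies \<open>a'\<close> with \<open>m\<close> and \<open>n\<close> with \<open>e\<close>, and \<open>q\<close> identifies \<open>a'\<close> with \<open>e\<close> and
  \<open>m\<close> with \<open>n\<close>. As \<open>m\<close> and \<open>n\<close> have equal reflections, the modular law shifts
  this to \<open>a'\<close> and \<open>e\<close>. So \<open>e\<close> and \<open>d'\<close> have the same reflection and the same image under
  \<open>p\<close>, whence \<open>e = d'\<close> and \<open>a = d\<close>.\<close>

lemma split_unit_separated:
  assumes f: "f \<in> hom C x y" and s: "s \<in> hom C y x" "f \<odot> s = Id C y"
    and g: "cover g c y" and pb: "is_pullback C g f p q" and p: "p \<in> hom C E c" and q: "q \<in> hom C E x"
    and sep: "unit_separated p"
  shows "unit_separated f"
proof (rule unit_separatedI[OF f])
  fix w a d assume a: "a \<in> hom C w x" and d: "d \<in> hom C w x"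
    and fad: "f \<odot> a = f \<odot> d" and eta: "\<eta> x \<odot> a = \<eta> x \<odot> d"
  note gh = cover_hom[OF g] and c = homD(4)[OF cover_hom[OF g]]
  have comm: "g \<odot> p = f \<odot> q" using pb unfolding is_pullback_def by blast
  have qc: "cover q E x" by (rule cover_pullback[OF pullback_flip[OF pb] q g])
  note hE = unit_hom[OF homD(4)[OF p]]
  obtain w' v a' d' where v: "cover v w' w" and a': "a' \<in> hom C w' E" and d': "d' \<in> hom C w' E"
    and qa': "q \<odot> a' = a \<odot> v" and qd': "q \<odot> d' = d \<odot> v" and eta': "\<eta> E \<odot> a' = \<eta> E \<odot> d'"
    using unit_kernel_lift[OF qc a d eta] .
  note vh = cover_hom[OF v] and w' = homD(4)[OF a']
  have fad': "f \<odot> (q \<odot> a') = f \<odot> (q \<odot> d')"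
    using comp_square[OF fad vh a f d f] qa' qd' by simp
  have gpd: "g \<odot> (p \<odot> d') = f \<odot> (q \<odot> a')"
    using comp_square[OF comm d' p gh q f] fad' by simp
  \<comment> \<open>the fourth corner: over \<open>p d'\<close>, with image \<open>a\<close>\<close>
  obtain e where e: "e \<in> hom C w' E" "p \<odot> e = p \<odot> d'" "q \<odot> e = q \<odot> a'"
    using pullback_lift[OF pb p q comp_hom[OF d' p] comp_hom[OF a' q] gpd] .
  have "g \<odot> Id C c = f \<odot> (s \<odot> g)"
    using comp_pre[OF s(2) gh s(1) f] comp_id_left[OF gh] comp_id_right[OF gh] by simp
  then obtain \<sigma> where \<sigma>: "\<sigma> \<in> hom C c E" "p \<odot> \<sigma> = Id C c" "q \<odot> \<sigma> = s \<odot> g"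
    using pullback_lift[OF pb p q id_hom[OF c] comp_hom[OF gh s(1)]] by metis
  define m where "m = \<sigma> \<odot> (p \<odot> a')"
  define n where "n = \<sigma> \<odot> (p \<odot> d')"
  note pa = comp_hom[OF a' p] and pd = comp_hom[OF d' p]
  have m: "m \<in> hom C w' E" "p \<odot> m = p \<odot> a'" "q \<odot> m = s \<odot> (g \<odot> (p \<odot> a'))"
    using comp_hom[OF pa \<sigma>(1)] comp_pre[OF \<sigma>(2) pa \<sigma>(1) p] comp_id_left[OF pa]
      comp_square[OF \<sigma>(3) pa \<sigma>(1) q gh s(1)] by (simp_all add: m_def)
  have n: "n \<in> hom C w' E" "p \<odot> n = p \<odot> d'" "q \<odot> n = s \<odot> (g \<odot> (p \<odot> d'))"
    using comp_hom[OF pd \<sigma>(1)] comp_pre[OF \<sigma>(2) pd \<sigma>(1) p] comp_id_left[OF pd]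
      comp_square[OF \<sigma>(3) pd \<sigma>(1) q gh s(1)] by (simp_all add: n_def)
  have qmn: "q \<odot> m = q \<odot> n"
    using m(3) n(3) gpd comp_square[OF comm a' p gh q f] by simp
  have etamn: "\<eta> E \<odot> m = \<eta> E \<odot> n"
    using unit_eq_natural[OF comp_hom[OF p \<sigma>(1)] a' d' eta'] comp_assoc[OF a' p \<sigma>(1)]
      comp_assoc[OF d' p \<sigma>(1)] by (simp add: m_def n_def)
  obtain R where R: "is_equiv_relation C E R"
    and Riff: "\<And>w a c. a \<in> hom C w E \<Longrightarrow> c \<in> hom C w E \<Longrightarrow> related R a c \<longleftrightarrow> p \<odot> a = p \<odot> c"
    by (rule kernel_relation_exists[OF p], rule that, assumption, simp only:)
  obtain K k where k: "k \<in> hom C E K"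
    and kiff: "\<And>w a c. a \<in> hom C w E \<Longrightarrow> c \<in> hom C w E \<Longrightarrow>
      k \<odot> a = k \<odot> c \<longleftrightarrow> q \<odot> a = q \<odot> c \<and> \<eta> E \<odot> a = \<eta> E \<odot> c"
    by (rule pairing_exists[OF q hE], rule that, assumption, simp only:)
  obtain Q where Q: "is_equiv_relation C E Q"
    and Qiff: "\<And>w a c. a \<in> hom C w E \<Longrightarrow> c \<in> hom C w E \<Longrightarrow> related Q a c \<longleftrightarrow> k \<odot> a = k \<odot> c"
    by (rule kernel_relation_exists[OF k], rule that, assumption, simp only:)
  have "related Q a' e"
  proof (rule modular_shift[OF R Q q _ _ a' e(1) _ cover_Id[OF w'] m(1) n(1)])
    fix w i j assume i: "i \<in> hom C w E" and j: "j \<in> hom C w E"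
    show "q \<odot> i = q \<odot> j" if "related Q i j"
      using that Qiff[OF i j] kiff[OF i j] by simp
    show "i = j" if "related R i j" "q \<odot> i = q \<odot> j"
      by (rule pullback_jointly_mono[OF pb p q i j _ that(2)]) (use that(1) Riff[OF i j] in blast)
  next
    show "q \<odot> a' = q \<odot> e" using e by simp
    show "related R (a' \<odot> Id C w') m" using Riff[OF a' m(1)] m(2) comp_id_right[OF a'] by simp
    show "related Q m n" using Qiff[OF m(1) n(1)] kiff[OF m(1) n(1)] qmn etamn by simp
    show "related R n (e \<odot> Id C w')" using Riff[OF n(1) e(1)] n(2) e(2) comp_id_right[OF e(1)] by simp
  qed
  then have "\<eta> E \<odot> a' = \<eta> E \<odot> e" using Qiff[OF a' e(1)] kiff[OF a' e(1)] by simp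
  then have "\<eta> E \<odot> e = \<eta> E \<odot> d'" using eta' by simp
  then have "e = d'" by (rule unit_separatedD[OF sep p e(1) d' e(2)])
  then have "a \<odot> v = d \<odot> v" using e(3) qa' qd' by simp
  then show "a = d" by (rule cover_cancel[OF v a d])
qed

text \<open>Let \<open>p\<close>, with second projection \<open>q\<close> to \<open>x\<close>, be a trivial pullback of \<open>f\<close> along an
  extension. The arrow \<open>k1\<close> is split by the diagonal, and pulled back along \<open>q\<close> it becomes a
  kernel pair projection of \<open>p\<close>, where separation is inherited from \<open>p\<close>.\<close>

lemma central_kernel_unit_separated:
  assumes cen: "central_extension C b \<eta> f" and f: "f \<in> hom C x y"
    and kp: "is_pullback C f f k1 k2" and k1: "k1 \<in> hom C K x" and k2: "k2 \<in> hom C K x"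
  shows "unit_separated k1"
proof -
  obtain g p q c E where g: "cover g c y" and pb: "is_pullback C g f p q"
    and p: "p \<in> hom C E c" and q: "q \<in> hom C E x" and triv: "trivial_extension C b \<eta> p"
    using central_extensionE[OF cen f] .
  note gh = cover_hom[OF g] and x = homD(4)[OF f]
  have comm: "g \<odot> p = f \<odot> q" and kcomm: "f \<odot> k1 = f \<odot> k2"
    using pb kp unfolding is_pullback_def by blast+
  have qc: "cover q E x" by (rule cover_pullback[OF pullback_flip[OF pb] q g])
  obtain d where d: "d \<in> hom C x K" "k1 \<odot> d = Id C x"
    using pullback_lift[OF kp k1 k2 id_hom[OF x] id_hom[OF x]] by metis
  obtain E' p' q' where pb': "is_pullback C q k1 p' q'" and p': "p' \<in> hom C E' E"
    and q': "q' \<in> hom C E' K" and comm': "q \<odot> p' = k1 \<odot> q'"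
    using pullback_exists[OF q k1] .
  \<comment> \<open>\<open>p'\<close> is also a pullback of \<open>p\<close>, along \<open>p\<close>, with second projection \<open>m\<close>\<close>
  have "g \<odot> (p \<odot> p') = f \<odot> (q \<odot> p')" by (rule comp_square[OF comm p' p gh q f])
  also have "\<dots> = f \<odot> (k2 \<odot> q')" using comp_square[OF kcomm q' k1 f k2 f] comm' by simp
  finally obtain m where m: "m \<in> hom C E' E" "p \<odot> m = p \<odot> p'" "q \<odot> m = k2 \<odot> q'"
    using pullback_lift[OF pb p q comp_hom[OF p' p] comp_hom[OF q' k2]] by metis
  have "unit_separated p'"
  proof (rule unit_separatedI[OF p'])
    fix w i j assume i: "i \<in> hom C w E'" and j: "j \<in> hom C w E'"
      and eq: "p' \<odot> i = p' \<odot> j" and eta: "\<eta> E' \<odot> i = \<eta> E' \<odot> j"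
    have "p \<odot> (m \<odot> i) = p \<odot> (m \<odot> j)"
      using comp_square[OF m(2) i m(1) p p' p] comp_square[OF m(2) j m(1) p p' p] eq by simp
    then have mij: "m \<odot> i = m \<odot> j"
      using unit_separatedD[OF trivial_unit_separated[OF triv p] p comp_hom[OF i m(1)] comp_hom[OF j m(1)]]
        unit_eq_natural[OF m(1) i j eta] by simp
    have "k1 \<odot> (q' \<odot> i) = k1 \<odot> (q' \<odot> j)"
      using comp_square[OF comm' i p' q q' k1] comp_square[OF comm' j p' q q' k1] eq by simp
    moreover have "k2 \<odot> (q' \<odot> i) = k2 \<odot> (q' \<odot> j)"
      using comp_square[OF m(3) i m(1) q q' k2] comp_square[OF m(3) j m(1) q q' k2] mij by simp
    ultimately have "q' \<odot> i = q' \<odot> j"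
      by (rule pullback_jointly_mono[OF kp k1 k2 comp_hom[OF i q'] comp_hom[OF j q']])
    with eq show "i = j" by (rule pullback_jointly_mono[OF pb' p' q' i j])
  qed
  then show ?thesis by (rule split_unit_separated[OF k1 d qc pb' p' q'])
qed

section \<open>Perfect objects and universal central extensions\<close>

lemma zero_arrows:
  assumes z: "is_zero C z" and x: "x \<in> Obj C"
  obtains t i where "t \<in> hom C x z" "i \<in> hom C z x"
  using assms unfolding is_zero_def is_terminal_def is_initial_def by metis

lemma to_zero_unique:
  assumes z: "is_zero C z" and a: "a \<in> hom C w z" and c: "c \<in> hom C w z"
  shows "a = c"
proof -
  have "\<exists>!f. f \<in> hom C w z"
    using z homD(4)[OF a] unfolding is_zero_def is_terminal_def by blast
  then show ?thesis using a c by blast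
qed

lemma from_zero_unique:
  assumes z: "is_zero C z" and a: "a \<in> hom C z w" and c: "c \<in> hom C z w"
  shows "a = c"
proof -
  have "\<exists>!f. f \<in> hom C z w"
    using z homD(5)[OF a] unfolding is_zero_def is_initial_def by blast
  then show ?thesis using a c by blast
qed

text \<open>Both composites factor through the initial object \<open>b U\<close>.\<close>

lemma perfect_arrows_unit_eq:
  assumes U: "perfect C b U" and a: "a \<in> hom C U y" and c: "c \<in> hom C U y"
  shows "\<eta> y \<odot> a = \<eta> y \<odot> c"
proof -
  have "is_initial C (OMap b U)" using U by (simp add: perfect_def is_zero_def)
  then have "MMap b a = MMap b c"
    using map_hom[OF a] map_hom[OF c] homD(5)[OF map_hom[OF a]] unfolding is_initial_def by blast
  then show ?thesis using unit_natural[OF a] unit_natural[OF c] by simp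
qed

text \<open>Compare the elements \<open>(h, k)\<close> and \<open>(h, h)\<close> of the kernel pair of \<open>f\<close>: they have the same
  first component, and the same reflection because \<open>U\<close> is perfect.\<close>

lemma perfect_central_cancel:
  assumes U: "perfect C b U" and cen: "central_extension C b \<eta> f" and f: "f \<in> hom C x y"
    and h: "h \<in> hom C U x" and k: "k \<in> hom C U x" and eq: "f \<odot> h = f \<odot> k"
  shows "h = k"
proof -
  obtain K k1 k2 where kp: "is_pullback C f f k1 k2" and k1: "k1 \<in> hom C K x" and k2: "k2 \<in> hom C K x"
    using pullback_exists[OF f f] .
  obtain i where i: "i \<in> hom C U K" "k1 \<odot> i = h" "k2 \<odot> i = k"
    using pullback_lift[OF kp k1 k2 h k eq] .
  obtain j where j: "j \<in> hom C U K" "k1 \<odot> j = h" "k2 \<odot> j = h"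
    using pullback_lift[OF kp k1 k2 h h refl] .
  have "i = j"
    using unit_separatedD[OF central_kernel_unit_separated[OF cen f kp k1 k2] k1 i(1) j(1)]
      perfect_arrows_unit_eq[OF U i(1) j(1)] i j by simp
  then show ?thesis using i j by simp
qed

text \<open>If \<open>\<eta>\<^sub>U\<close> factors through \<open>z\<close> then, by universality, so does the identity of \<open>b U\<close>.\<close>

lemma unit_zero_perfect:
  assumes U: "U \<in> Obj C" and z: "is_zero C z"
    and t: "t \<in> hom C U z" and i: "i \<in> hom C z (OMap b U)" and eq: "\<eta> U = i \<odot> t"
  shows "perfect C b U"
proof -
  note h = unit_hom[OF U]
  define x where "x = OMap b U"
  have x: "x \<in> Obj C" using homD(5)[OF h] by (simp add: x_def)
  have ix: "i \<in> hom C z x" using i by (simp add: x_def)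
  note zt = to_zero_unique[OF z] and zi = from_zero_unique[OF z]
  obtain r where r: "r \<in> hom C x z" using zero_arrows[OF z x] by blast
  have "r \<odot> \<eta> U = t" using zt[OF comp_hom[OF h r[unfolded x_def]] t] by simp
  then have "(i \<odot> r) \<odot> \<eta> U = Id C x \<odot> \<eta> U"
    using comp_assoc[OF h r[unfolded x_def] i] eq comp_id_left[OF h] by (simp add: x_def)
  then have ir: "i \<odot> r = Id C x"
    using unit_cancel[OF U _ _ reflection_in_B[OF U]] comp_hom[OF r ix] id_hom[OF x] unfolding x_def
    by blast
  have "is_terminal C x"
    unfolding is_terminal_def
  proof (intro conjI ballI x)
    fix w assume "w \<in> Obj C"
    then obtain a where a: "a \<in> hom C w z" using zero_arrows[OF z] by blast
    have "c = i \<odot> a" if c: "c \<in> hom C w x" for c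
      using comp_pre[OF ir c r ix] comp_id_left[OF c] zt[OF comp_hom[OF c r] a] by simp
    then show "\<exists>!c. c \<in> hom C w x" using comp_hom[OF a ix] by blast
  qed
  moreover have "is_initial C x"
    unfolding is_initial_def
  proof (intro conjI ballI x)
    fix w assume "w \<in> Obj C"
    then obtain a where a: "a \<in> hom C z w" using zero_arrows[OF z] by blast
    have "c = a \<odot> r" if c: "c \<in> hom C x w" for c
    proof -
      have "c = (c \<odot> i) \<odot> r" using comp_assoc[OF r ix c] ir comp_id_right[OF c] by simp
      then show ?thesis using zi[OF comp_hom[OF ix c] a] by simp
    qed
    then show "\<exists>!c. c \<in> hom C x w" using comp_hom[OF r a] by blast
  qed
  ultimately show ?thesis using U by (simp add: perfect_def is_zero_def x_def)
qed

text \<open>The zero arrow is a section of \<open>t\<close>. In the naturality square \<open>\<eta>\<^sub>x\<close> is invertible, because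
  \<open>x\<close> lies in \<open>B\<close>, and a component in \<open>z\<close> carries no information.\<close>

lemma zero_projection_trivial:
  assumes x: "x \<in> B" and z: "is_zero C z" and t: "t \<in> hom C x z"
  shows "trivial_extension C b \<eta> t"
proof -
  note xo = homD(4)[OF t] and zo = homD(5)[OF t]
  note hx = unit_hom[OF xo] and hz = unit_hom[OF zo]
  note zt = to_zero_unique[OF z]
  obtain i where i: "i \<in> hom C z x" by (rule zero_arrows[OF z xo])
  have "t \<odot> i = Id C z" by (rule zt[OF comp_hom[OF i t] id_hom[OF zo]])
  then have tc: "cover t x z" by (rule split_cover[OF t i])
  obtain r where r: "r \<in> hom C (OMap b x) x" "r \<odot> \<eta> x = Id C x"
    using unit_factor[OF id_hom[OF xo] x] .
  have "(\<eta> x \<odot> r) \<odot> \<eta> x = Id C (OMap b x) \<odot> \<eta> x"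
    using comp_assoc[OF hx r(1) hx] r(2) comp_id_right[OF hx] comp_id_left[OF hx] by simp
  then have hr: "\<eta> x \<odot> r = Id C (OMap b x)"
    by (rule unit_cancel[OF xo comp_hom[OF r(1) hx] id_hom[OF homD(5)[OF hx]] reflection_in_B[OF xo]])
  have "is_pullback C (MMap b t) (\<eta> z) (\<eta> x) t"
  proof (rule pullbackI[OF map_hom[OF t] hz hx t unit_natural[OF t]])
    fix w a c assume a: "a \<in> hom C w (OMap b x)" and c: "c \<in> hom C w z"
    have "\<eta> x \<odot> (r \<odot> a) = a" using comp_pre[OF hr a r(1) hx] comp_id_left[OF a] by simp
    moreover have "t \<odot> (r \<odot> a) = c" by (rule zt[OF comp_hom[OF comp_hom[OF a r(1)] t] c])
    ultimately show "\<exists>h\<in>hom C w x. \<eta> x \<odot> h = a \<and> t \<odot> h = c" using comp_hom[OF a r(1)] by blast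
  next
    fix w a c assume a: "a \<in> hom C w x" and c: "c \<in> hom C w x" and eq: "\<eta> x \<odot> a = \<eta> x \<odot> c"
    have "a = r \<odot> (\<eta> x \<odot> a)" using comp_pre[OF r(2) a hx r(1)] comp_id_left[OF a] by simp
    also have "\<dots> = c" using comp_pre[OF r(2) c hx r(1)] comp_id_left[OF c] by (simp add: eq)
    finally show "a = c" .
  qed
  then show ?thesis by (rule trivial_extensionI[OF tc])
qed

lemma Centr_obj: "f \<in> Obj (Centr C b \<eta> y) \<longleftrightarrow> f \<in> Mor C \<and> Cod C f = y \<and> central_extension C b \<eta> f"
  by (auto simp: Centr_def full_subcat_def slice_cat_def)

lemma Centr_hom:
  assumes "f \<in> Obj (Centr C b \<eta> y)" "g \<in> Obj (Centr C b \<eta> y)"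
  shows "m \<in> hom (Centr C b \<eta> y) f g \<longleftrightarrow>
    (\<exists>h\<in>hom C (Dom C f) (Dom C g). g \<odot> h = f \<and> m = (f, h, g))"
  using assms unfolding Centr_obj by (auto simp: hom_def Centr_def full_subcat_def slice_cat_def)

text \<open>Lifting \<open>g\<close> through \<open>f\<close> amounts to splitting the pullback of \<open>f\<close> along \<open>g\<close>, which is
  a central extension of \<open>U\<close>.\<close>

lemma central_split_iff_projective:
  assumes U: "U \<in> Obj C"
  shows "(\<forall>f. central_extension C b \<eta> f \<and> Cod C f = U \<longrightarrow> splits C f) \<longleftrightarrow>
    projective_wrt_central C b \<eta> U"
proof
  assume split: "\<forall>f. central_extension C b \<eta> f \<and> Cod C f = U \<longrightarrow> splits C f"
  have "\<exists>h\<in>hom C U (Dom C f). f \<odot> h = g"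
    if cen: "central_extension C b \<eta> f" and g: "g \<in> hom C U (Cod C f)" for f g
  proof -
    have "f \<in> Mor C"
      using cen unfolding central_extension_def is_pullback_def by blast
    note f = hom_dom_cod[OF this]
    obtain P p q where pb: "is_pullback C g f p q" and p: "p \<in> hom C P U"
      and q: "q \<in> hom C P (Dom C f)" and comm: "g \<odot> p = f \<odot> q"
      using pullback_exists[OF g f] .
    have "splits C p" using split central_pullback[OF cen f g pb p q] homD[OF p] by blast
    then obtain s where s: "s \<in> hom C U P" "p \<odot> s = Id C U"
      using homD[OF p] by (auto simp: splits_def)
    have "f \<odot> (q \<odot> s) = g"
      using comp_square[OF comm s(1) p g q f] s(2) comp_id_right[OF g] by simp
    then show ?thesis using comp_hom[OF s(1) q] by blast
  qed
  then show "projective_wrt_central C b \<eta> U" using U by (simp add: projective_wrt_central_def)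
next
  assume "projective_wrt_central C b \<eta> U"
  then show "\<forall>f. central_extension C b \<eta> f \<and> Cod C f = U \<longrightarrow> splits C f"
    using id_hom[OF U] unfolding projective_wrt_central_def splits_def by blast
qed

lemma perfect_projective_bij:
  assumes U: "perfect C b U" and proj: "projective_wrt_central C b \<eta> U"
    and cen: "central_extension C b \<eta> f" and f: "f \<in> hom C x y"
  shows "bij_betw (\<lambda>h. f \<odot> h) (hom C U x) (hom C U y)"
  unfolding bij_betw_def
proof
  show "inj_on (\<lambda>h. f \<odot> h) (hom C U x)"
    by (rule inj_onI) (rule perfect_central_cancel[OF U cen f])
  have "\<exists>h\<in>hom C U x. f \<odot> h = g" if "g \<in> hom C U y" for g
    using proj cen that homD[OF f] unfolding projective_wrt_central_def by blast
  then show "(\<lambda>h. f \<odot> h) ` hom C U x = hom C U y"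
    using comp_hom[OF _ f] by blast
qed

lemma bij_projective:
  assumes U: "U \<in> Obj C"
    and bij: "\<And>x y f. f \<in> hom C x y \<Longrightarrow> central_extension C b \<eta> f \<Longrightarrow>
      bij_betw (\<lambda>h. f \<odot> h) (hom C U x) (hom C U y)"
  shows "projective_wrt_central C b \<eta> U"
  unfolding projective_wrt_central_def
proof (intro conjI allI impI ballI U)
  fix f g assume cen: "central_extension C b \<eta> f" and g: "g \<in> hom C U (Cod C f)"
  have "f \<in> Mor C"
    using cen unfolding central_extension_def is_pullback_def by blast
  then have "g \<in> (\<lambda>h. f \<odot> h) ` hom C U (Dom C f)"
    using bij[OF hom_dom_cod cen] g by (simp add: bij_betw_def)
  then show "\<exists>h\<in>hom C U (Dom C f). f \<odot> h = g" by blast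
qed

text \<open>The arrow \<open>b U \<rightarrow> 0\<close> is a trivial extension, so \<open>\<eta>\<^sub>U\<close> and the zero arrow, which have the
  same composite with it, agree.\<close>

lemma bij_perfect:
  assumes U: "U \<in> Obj C" and z: "is_zero C z"
    and bij: "\<And>x y f. f \<in> hom C x y \<Longrightarrow> central_extension C b \<eta> f \<Longrightarrow>
      bij_betw (\<lambda>h. f \<odot> h) (hom C U x) (hom C U y)"
  shows "perfect C b U"
proof -
  note h = unit_hom[OF U]
  obtain t where t: "t \<in> hom C U z" by (rule zero_arrows[OF z U])
  obtain t' i where t': "t' \<in> hom C (OMap b U) z" and i: "i \<in> hom C z (OMap b U)"
    by (rule zero_arrows[OF z homD(5)[OF h]])
  have "central_extension C b \<eta> t'"
    by (rule trivial_central[OF zero_projection_trivial[OF reflection_in_B[OF U] z t'] t'])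
  then have inj: "inj_on (\<lambda>h. t' \<odot> h) (hom C U (OMap b U))"
    using bij[OF t'] by (simp add: bij_betw_def)
  have "t' \<odot> \<eta> U = t' \<odot> (i \<odot> t)"
    by (rule to_zero_unique[OF z comp_hom[OF h t'] comp_hom[OF comp_hom[OF t i] t']])
  then have "\<eta> U = i \<odot> t" by (rule inj_onD[OF inj _ h comp_hom[OF t i]])
  then show ?thesis by (rule unit_zero_perfect[OF U z t i])
qed

text \<open>The projection \<open>p : y \<times> b U \<rightarrow> y\<close> is a trivial extension, as a pullback of \<open>b U \<rightarrow> 0\<close>. The
  arrows \<open>(u, \<eta>\<^sub>U)\<close> and \<open>(u, 0)\<close> are both morphisms of extensions from \<open>u\<close> to \<open>p\<close>, so by
  initiality they agree.\<close>

lemma universal_perfect: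
  assumes u: "u \<in> hom C U y" and z: "is_zero C z"
    and univ: "universal_central_extension C b \<eta> y u"
  shows "perfect C b U"
proof -
  note U = homD(4)[OF u] and y = homD(5)[OF u]
  note h = unit_hom[OF U]
  obtain t where t: "t \<in> hom C U z" by (rule zero_arrows[OF z U])
  obtain a where a: "a \<in> hom C y z" by (rule zero_arrows[OF z y])
  obtain t' i where t': "t' \<in> hom C (OMap b U) z" and i: "i \<in> hom C z (OMap b U)"
    by (rule zero_arrows[OF z homD(5)[OF h]])
  obtain P p q where pb: "is_pullback C a t' p q" and p: "p \<in> hom C P y"
    and q: "q \<in> hom C P (OMap b U)"
    using pullback_exists[OF a t'] .
  note triv = zero_projection_trivial[OF reflection_in_B[OF U] z t']
  have "central_extension C b \<eta> p"
    by (rule trivial_central[OF trivial_pullback[OF triv t' a pb p q] p])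
  then have pC: "p \<in> Obj (Centr C b \<eta> y)" using homD[OF p] by (simp add: Centr_obj)
  have ini: "is_initial (Centr C b \<eta> y) u" using univ by (simp add: universal_central_extension_def)
  then have uC: "u \<in> Obj (Centr C b \<eta> y)" by (simp add: is_initial_def)
  have uniq: "\<exists>!m. m \<in> hom (Centr C b \<eta> y) u p" using ini pC by (simp add: is_initial_def)
  have lift: "\<exists>k\<in>hom C U P. p \<odot> k = u \<and> q \<odot> k = c" if c: "c \<in> hom C U (OMap b U)" for c
    using pullback_lift[OF pb p q u c to_zero_unique[OF z comp_hom[OF u a] comp_hom[OF c t']]]
    by blast
  obtain k where k: "k \<in> hom C U P" "p \<odot> k = u" "q \<odot> k = \<eta> U" using lift[OF h] by blast
  obtain l where l: "l \<in> hom C U P" "p \<odot> l = u" "q \<odot> l = i \<odot> t"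
    using lift[OF comp_hom[OF t i]] by blast
  have "(u, k, p) \<in> hom (Centr C b \<eta> y) u p" "(u, l, p) \<in> hom (Centr C b \<eta> y) u p"
    using Centr_hom[OF uC pC] k l homD[OF u] homD[OF p] by simp_all
  then have "k = l" using uniq by blast
  then have "\<eta> U = i \<odot> t" using k l by simp
  then show ?thesis by (rule unit_zero_perfect[OF U z t i])
qed

lemma perfect_weakly_universal_iff_universal:
  assumes u: "u \<in> hom C U y" and z: "is_zero C z"
  shows "perfect C b U \<and> weakly_universal_central_extension C b \<eta> y u \<longleftrightarrow>
    universal_central_extension C b \<eta> y u"
proof
  assume asm: "perfect C b U \<and> weakly_universal_central_extension C b \<eta> y u"
  then have U: "perfect C b U" and uC: "u \<in> Obj (Centr C b \<eta> y)"
    and weak: "\<forall>f\<in>Obj (Centr C b \<eta> y). \<exists>m. m \<in> hom (Centr C b \<eta> y) u f"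
    by (simp_all add: weakly_universal_central_extension_def is_weakly_initial_def)
  have "m = n" if fC: "f \<in> Obj (Centr C b \<eta> y)" and m: "m \<in> hom (Centr C b \<eta> y) u f"
    and n: "n \<in> hom (Centr C b \<eta> y) u f" for f m n
  proof -
    have f: "f \<in> hom C (Dom C f) y" and cen: "central_extension C b \<eta> f"
      using fC by (simp_all add: Centr_obj hom_def)
    obtain h where h: "h \<in> hom C U (Dom C f)" "f \<odot> h = u" "m = (u, h, f)"
      using m unfolding Centr_hom[OF uC fC] homD(2)[OF u] by blast
    obtain k where k: "k \<in> hom C U (Dom C f)" "f \<odot> k = u" "n = (u, k, f)"
      using n unfolding Centr_hom[OF uC fC] homD(2)[OF u] by blast
    have "f \<odot> h = f \<odot> k" using h k by simp
    then have "h = k" by (rule perfect_central_cancel[OF U cen f h(1) k(1)])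
    then show "m = n" using h k by simp
  qed
  then show "universal_central_extension C b \<eta> y u"
    using uC weak unfolding universal_central_extension_def is_initial_def by blast
next
  assume univ: "universal_central_extension C b \<eta> y u"
  then have "weakly_universal_central_extension C b \<eta> y u"
    unfolding universal_central_extension_def weakly_universal_central_extension_def
      is_initial_def is_weakly_initial_def by blast
  then show "perfect C b U \<and> weakly_universal_central_extension C b \<eta> y u"
    using universal_perfect[OF u z univ] by blast
qed

lemma projective_weakly_universal:
  assumes u: "u \<in> hom C U y" and cen: "central_extension C b \<eta> u"
    and proj: "projective_wrt_central C b \<eta> U"
  shows "weakly_universal_central_extension C b \<eta> y u"
proof -
  have uC: "u \<in> Obj (Centr C b \<eta> y)" using cen homD[OF u] by (simp add: Centr_obj)
  have "\<exists>m. m \<in> hom (Centr C b \<eta> y) u f" if fC: "f \<in> Obj (Centr C b \<eta> y)" for f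
  proof -
    have "central_extension C b \<eta> f" "u \<in> hom C U (Cod C f)"
      using fC u by (simp_all add: Centr_obj)
    then obtain h where "h \<in> hom C U (Dom C f)" "f \<odot> h = u"
      using proj unfolding projective_wrt_central_def by blast
    then show ?thesis using Centr_hom[OF uC fC] homD(2)[OF u] by blast
  qed
  then show ?thesis
    using uC by (simp add: weakly_universal_central_extension_def is_weakly_initial_def)
qed

end

theorem proposition1p11:
  fixes \<A> :: "('o, 'm) cat"
    and \<B> :: "'o set"
    and b :: "('o, 'm, 'o, 'm) ftor"
    and \<eta> :: "'o \<Rightarrow> 'm"
    and U A :: 'o
    and u :: 'm
  assumes "category \<A>" and "pointed \<A>" and "barr_exact \<A>" and "goursat \<A>"
    and "birkhoff_subcategory \<A> \<B>" and "is_reflector \<A> \<B> b \<eta>"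
    and "u \<in> hom \<A> U A" and "central_extension \<A> b \<eta> u"
  shows "let
      c1 = (perfect \<A> b U \<and> (\<forall>f. central_extension \<A> b \<eta> f \<and> Cod \<A> f = U \<longrightarrow> splits \<A> f));
      c2 = (perfect \<A> b U \<and> projective_wrt_central \<A> b \<eta> U);
      c3 = (\<forall>X Y. \<forall>f\<in>hom \<A> X Y. central_extension \<A> b \<eta> f \<longrightarrow>
              bij_betw (\<lambda>h. f \<odot>\<^bsub>\<A>\<^esub> h) (hom \<A> U X) (hom \<A> U Y));
      c4 = (perfect \<A> b U \<and> weakly_universal_central_extension \<A> b \<eta> A u);
      c5 = universal_central_extension \<A> b \<eta> A u
    in (c1 \<longleftrightarrow> c2) \<and> (c2 \<longleftrightarrow> c3) \<and> (c3 \<longrightarrow> c4) \<and> (c4 \<longleftrightarrow> c5)"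
proof -
  interpret birkhoff \<A> \<B> b \<eta>
  proof (intro birkhoff.intro goursat_cat.intro regular_cat.intro regular_cat_axioms.intro
      goursat_cat_axioms.intro birkhoff_axioms.intro)
    show "regular_category \<A>" using assms(3) by (simp add: barr_exact_def)
  qed (fact assms)+
  note U = homD(4)[OF assms(7)]
  obtain z where z: "is_zero \<A> z" using assms(2) by (auto simp: pointed_def)
  define c1 where "c1 \<longleftrightarrow> perfect \<A> b U \<and>
    (\<forall>f. central_extension \<A> b \<eta> f \<and> Cod \<A> f = U \<longrightarrow> splits \<A> f)"
  define c2 where "c2 \<longleftrightarrow> perfect \<A> b U \<and> projective_wrt_central \<A> b \<eta> U"
  define c3 where "c3 \<longleftrightarrow> (\<forall>X Y. \<forall>f\<in>hom \<A> X Y. central_extension \<A> b \<eta> f \<longrightarrow>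
    bij_betw (\<lambda>h. f \<odot>\<^bsub>\<A>\<^esub> h) (hom \<A> U X) (hom \<A> U Y))"
  define c4 where "c4 \<longleftrightarrow> perfect \<A> b U \<and> weakly_universal_central_extension \<A> b \<eta> A u"
  define c5 where "c5 \<longleftrightarrow> universal_central_extension \<A> b \<eta> A u"
  have "c1 \<longleftrightarrow> c2"
    unfolding c1_def c2_def using central_split_iff_projective[OF U] by blast
  moreover have "c2 \<longleftrightarrow> c3"
  proof
    assume c2
    then show c3 unfolding c2_def c3_def using perfect_projective_bij by blast
  next
    assume c3
    then have bij: "bij_betw (\<lambda>h. f \<odot>\<^bsub>\<A>\<^esub> h) (hom \<A> U X) (hom \<A> U Y)"
      if "f \<in> hom \<A> X Y" "central_extension \<A> b \<eta> f" for X Y f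
      unfolding c3_def using that by blast
    show c2 unfolding c2_def using bij_perfect[OF U z bij] bij_projective[OF U bij] by blast
  qed
  moreover have "c2 \<longrightarrow> c4"
    unfolding c2_def c4_def using projective_weakly_universal[OF assms(7,8)] by blast
  moreover have "c4 \<longleftrightarrow> c5"
    unfolding c4_def c5_def by (rule perfect_weakly_universal_iff_universal[OF assms(7) z])
  ultimately show ?thesis
    unfolding Let_def c1_def[symmetric] c2_def[symmetric] c3_def[symmetric] c4_def[symmetric]
      c5_def[symmetric] by blast
qed

end
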